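(* Let $\mathbb{P}$ be an $r$-rectangular uncertainty set with factor sets $\mathcal{W}^1,\dots,\mathcal{W}^r$ satisfying the tractability assumption stated in the context. Consider the algorithm (VI-PI) $$v^0=0,\qquad v^{k+1}_s=\max_{a\in\mathcal{A}}\Big\{r_{sa}+\lambda\sum_{i=1}^r u^i_{sa}\min_{w_i\in\mathcal{W}^i}w_i^\top v^k\Big\},\quad \forall s\in\mathcal{S},\ \forall k\ge0.$$ Then the algorithm (VI-PI) returns an $\epsilon$-optimal solution to the policy improvement problem in $$O\Big(rSA\log(\epsilon^{-1})+\sum_{i=1}^r comp(\mathcal{W}^i)\log^2(\epsilon^{-1})\Big)$$ arithmetic operations.
   Context: MDP setting: finite state set $\mathcal{S}$, $|\mathcal{S}|=S$; finite action set $\mathcal{A}$, $|\mathcal{A}|=A$; rewards $r_{sa}\ge0$; discount factor $\lambda\in(0,1)$; initial probability distribution $p_0$ on $\mathcal{S}$. $\Pi$ is the set of stationary (possibly randomized) policies. For a policy $\pi$ and kernel $P$, $R(\pi,P)=\mathbb{E}^{\pi,P}\big[\sum_{t\ge0}\lambda^t r_{s_ta_t}\mid s_0\sim p_0\big]$. $r$-rectangular uncertainty set: fix an integer $r\ge1$, coefficients $u^i_{sa}\ge0$ with $\sum_{i=1}^r u^i_{sa}=1$ for all $(s,a)$, and sets $\mathcal{W}^1,\dots,\mathcal{W}^r$ of probability vectors in $\mathbb{R}^S_+$; put $\mathcal{W}=\mathcal{W}^1\times\dots\times\mathcal{W}^r$. Each $W=(w_1,\dots,w_r)\in\mathcal{W}$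 determines the kernel $P_{sas'}=\sum_{i=1}^r u^i_{sa}w_{i,s'}$, and $\mathbb{P}$ is the set of all these kernels. Tractability assumption: the $\mathcal{W}^i$ are (nonempty) convex compact and, for any $i$ and any cost vector $c\in\mathbb{R}^S$, an $\epsilon$-optimal solution of $\min_{w_i\in\mathcal{W}^i}c^\top w_i$ can be found in $O(comp(\mathcal{W}^i)\log(\epsilon^{-1}))$ arithmetic operations, where $comp(\mathcal{W}^i)\in\mathbb{R}$ depends only on the structure of $\mathcal{W}^i$. The inner minimizations in (VI-PI) are carried out approximately by this procedure, to an accuracy proportional to $\epsilon$, and the iteration is stopped when successive iterates are close enough (threshold proportional to $\epsilon$). The policy improvement problem is $\max_{\pi}\min_{P\in\mathbb{P}}R(\pi,P)$. Let $v^{\pi,W}_s$ be the expected discounted reward from initial state $s$ under $\pi\in\Pi$ and the kernel determined by $W$, and let $v^*_s=\max_{\pi\in\Pi}\min_{W\in\mathcal{W}}v_s^{\pi,W}$. An $\epsilon$-optimal solution returned by the algorithm is an iterate $v$ with $\|v-v^*\|_\infty\le\epsilon$. The constant in $O(\cdot)$ may depend on $\lambda$ and on the size of the rewards. *)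

theory Defs
  imports "HOL-Probability.Probability" "HOL-Library.While_Combinator" "HOL-Library.Monad_Syntax"
begin

section \<open>Robust MDPs with an r-rectangular uncertainty set\<close>

text \<open>
  The numbers of states, of actions and of factors are fields of the record rather than types, so
  that one \<open>O\<close>-constant can be quantified before all three. States, actions and factor indices
  are \<open>{..<nS M}\<close>, \<open>{..<nA M}\<close> and \<open>{..<nF M}\<close>. A vector of \<open>\<real>\<^sup>S\<close> is a function
  \<open>nat \<Rightarrow> real\<close> that vanishes outside \<open>{..<nS M}\<close>. In \<open>coef M i s a\<close> the factor index
  comes first.
\<close>

type_synonym vect = "nat \<Rightarrow> real"

record rmdp =
  nS :: nat
  nA :: nat
  nF :: nat
  rew :: "nat \<Rightarrow> nat \<Rightarrow> real"
  disc :: real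
  coef :: "nat \<Rightarrow> nat \<Rightarrow> nat \<Rightarrow> real"
  factor :: "nat \<Rightarrow> vect set"

definition vectors :: "nat \<Rightarrow> vect set" where
  "vectors n = {w. \<forall>s\<ge>n. w s = 0}"

definition prob_vectors :: "nat \<Rightarrow> vect set" where
  "prob_vectors n = {w \<in> vectors n. (\<forall>s<n. 0 \<le> w s) \<and> (\<Sum>s<n. w s) = 1}"

definition dot :: "nat \<Rightarrow> vect \<Rightarrow> vect \<Rightarrow> real" where
  "dot n x y = (\<Sum>s<n. x s * y s)"

text \<open>
  The type \<open>nat \<Rightarrow> real\<close> is not an instance of \<open>real_vector\<close>, hence convexity is written
  out; \<open>compact\<close> refers to the product topology, which on \<open>vectors n\<close> is the Euclidean one.
\<close>

definition convex_vectors :: "vect set \<Rightarrow> bool" where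
  "convex_vectors X \<longleftrightarrow>
     (\<forall>x\<in>X. \<forall>y\<in>X. \<forall>t. 0 \<le> t \<and> t \<le> 1 \<longrightarrow> (\<lambda>s. (1 - t) * x s + t * y s) \<in> X)"

definition r_rectangular_mdp :: "rmdp \<Rightarrow> bool" where
  "r_rectangular_mdp M \<longleftrightarrow>
     1 \<le> nS M \<and> 1 \<le> nA M \<and> 1 \<le> nF M \<and> 0 < disc M \<and> disc M < 1 \<and>
     (\<forall>s<nS M. \<forall>a<nA M. 0 \<le> rew M s a) \<and>
     (\<forall>s<nS M. \<forall>a<nA M. (\<forall>i<nF M. 0 \<le> coef M i s a) \<and> (\<Sum>i<nF M. coef M i s a) = 1) \<and>
     (\<forall>i<nF M. factor M i \<subseteq> prob_vectors (nS M))"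

definition factor_vectors :: "rmdp \<Rightarrow> (nat \<Rightarrow> vect) set" where
  "factor_vectors M = (\<Pi>\<^sub>E i\<in>{..<nF M}. factor M i)"

definition kernel :: "rmdp \<Rightarrow> (nat \<Rightarrow> vect) \<Rightarrow> nat \<Rightarrow> nat \<Rightarrow> nat \<Rightarrow> real" where
  "kernel M W s a s' = (\<Sum>i<nF M. coef M i s a * W i s')"


section \<open>Expected discounted reward\<close>

definition policies :: "rmdp \<Rightarrow> (nat \<Rightarrow> nat pmf) set" where
  "policies M = {\<pi>. \<forall>s<nS M. set_pmf (\<pi> s) \<subseteq> {..<nA M}}"

definition act :: "(nat \<Rightarrow> nat pmf) \<Rightarrow> nat \<Rightarrow> (nat \<times> nat) pmf" where
  "act \<pi> s = map_pmf (Pair s) (\<pi> s)"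

text \<open>
  \<open>traj_step p \<pi> P t \<omega>\<close> is the distribution of \<open>(s\<^sub>t, a\<^sub>t)\<close> given
  \<open>\<omega> 0, \<dots>, \<omega> (t - 1)\<close>, where \<open>\<omega> k = (s\<^sub>k, a\<^sub>k)\<close>. The law of the whole trajectory
  is obtained from these kernels by the Ionescu-Tulcea construction.
\<close>

primrec traj_step ::
  "nat pmf \<Rightarrow> (nat \<Rightarrow> nat pmf) \<Rightarrow> (nat \<Rightarrow> nat \<Rightarrow> nat \<Rightarrow> real)
     \<Rightarrow> nat \<Rightarrow> (nat \<Rightarrow> nat \<times> nat) \<Rightarrow> (nat \<times> nat) measure" where
  "traj_step p \<pi> P 0 = (\<lambda>\<omega>. measure_pmf (bind_pmf p (act \<pi>)))"
| "traj_step p \<pi> P (Suc t) =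
     (\<lambda>\<omega>. measure_pmf (bind_pmf (embed_pmf (P (fst (\<omega> t)) (snd (\<omega> t)))) (act \<pi>)))"

lemma Ionescu_Tulcea_traj_step: "Ionescu_Tulcea (traj_step p \<pi> P) (\<lambda>_. count_space UNIV)"
proof (rule Ionescu_Tulcea.intro)
  fix t
  show "traj_step p \<pi> P t
          \<in> measurable (PiM {0..<t} (\<lambda>_. count_space UNIV)) (subprob_algebra (count_space UNIV))"
  proof (cases t)
    case 0
    then show ?thesis
      by (simp add: measurable_const measure_pmf_in_subprob_algebra)
  next
    case (Suc k)
    let ?g = "\<lambda>x. measure_pmf (bind_pmf (embed_pmf (P (fst x) (snd x))) (act \<pi>))"
    have g: "?g \<in> measurable (count_space UNIV) (subprob_algebra (count_space UNIV))"
      by (simp add: measure_pmf_in_subprob_algebra)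
    have "(\<lambda>\<omega>. \<omega> k) \<in> measurable (PiM {0..<t} (\<lambda>_. count_space UNIV)) (count_space UNIV)"
      using Suc by (intro measurable_component_singleton) auto
    from measurable_compose[OF this g] show ?thesis
      using Suc by simp
  qed
next
  fix t and \<omega> :: "nat \<Rightarrow> nat \<times> nat"
  show "prob_space (traj_step p \<pi> P t \<omega>)"
    by (cases t) (simp_all add: prob_space_measure_pmf)
qed

definition trajectories ::
  "nat pmf \<Rightarrow> (nat \<Rightarrow> nat pmf) \<Rightarrow> (nat \<Rightarrow> nat \<Rightarrow> nat \<Rightarrow> real) \<Rightarrow> (nat \<Rightarrow> nat \<times> nat) measure" where
  "trajectories p \<pi> P =
     projective_family.lim UNIV
       (Ionescu_Tulcea.CI (traj_step p \<pi> P) (\<lambda>_. count_space UNIV)) (\<lambda>_. count_space UNIV)"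

definition expected_return ::
  "rmdp \<Rightarrow> nat pmf \<Rightarrow> (nat \<Rightarrow> nat pmf) \<Rightarrow> (nat \<Rightarrow> nat \<Rightarrow> nat \<Rightarrow> real) \<Rightarrow> real" where
  "expected_return M p \<pi> P =
     (\<integral>\<omega>. (\<Sum>t. disc M ^ t * rew M (fst (\<omega> t)) (snd (\<omega> t))) \<partial>trajectories p \<pi> P)"

definition policy_value :: "rmdp \<Rightarrow> (nat \<Rightarrow> nat pmf) \<Rightarrow> (nat \<Rightarrow> vect) \<Rightarrow> nat \<Rightarrow> real" where
  "policy_value M \<pi> W s = expected_return M (return_pmf s) \<pi> (kernel M W)"

definition robust_value :: "rmdp \<Rightarrow> nat \<Rightarrow> real" where
  "robust_value M s = (SUP \<pi>\<in>policies M. INF W\<in>factor_vectors M. policy_value M \<pi> W s)"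

definition eps_optimal :: "rmdp \<Rightarrow> real \<Rightarrow> vect \<Rightarrow> bool" where
  "eps_optimal M \<epsilon> v \<longleftrightarrow> (\<forall>s<nS M. \<bar>v s - robust_value M s\<bar> \<le> \<epsilon>)"


section \<open>Counting arithmetic operations\<close>

text \<open>
  A computation is a result together with the number of operations spent on it. Each addition,
  subtraction, multiplication, division, comparison, maximum and absolute value of reals costs 1;
  reading the data, storing results and loop indices are free.
\<close>

type_synonym 'a counted = "'a \<times> nat"

definition free :: "'a \<Rightarrow> 'a counted" where
  "free x = (x, 0)"

definition op1 :: "'a \<Rightarrow> 'a counted" where
  "op1 x = (x, 1)"

definition bind_counted :: "'a counted \<Rightarrow> ('a \<Rightarrow> 'b counted) \<Rightarrow> 'b counted" where
  "bind_counted m f = (fst (f (fst m)), snd m + snd (f (fst m)))"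

adhoc_overloading Monad_Syntax.bind \<rightleftharpoons> bind_counted

primrec sum_counted :: "(nat \<Rightarrow> real counted) \<Rightarrow> nat \<Rightarrow> real counted" where
  "sum_counted f 0 = free 0"
| "sum_counted f (Suc n) = do {
     x \<leftarrow> sum_counted f n;
     y \<leftarrow> f n;
     op1 (x + y)
   }"

text \<open>Maximum over \<open>{0..n}\<close>, with \<open>n\<close> included.\<close>

primrec max_counted :: "(nat \<Rightarrow> real counted) \<Rightarrow> nat \<Rightarrow> real counted" where
  "max_counted f 0 = f 0"
| "max_counted f (Suc n) = do {
     x \<leftarrow> max_counted f n;
     y \<leftarrow> f (Suc n);
     op1 (max x y)
   }"

primrec vect_counted :: "(nat \<Rightarrow> real counted) \<Rightarrow> nat \<Rightarrow> vect counted" where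
  "vect_counted f 0 = free (\<lambda>_. 0)"
| "vect_counted f (Suc n) = do {
     v \<leftarrow> vect_counted f n;
     x \<leftarrow> f n;
     free (v(n := x))
   }"

definition dot_counted :: "nat \<Rightarrow> vect \<Rightarrow> vect \<Rightarrow> real counted" where
  "dot_counted n x y = sum_counted (\<lambda>s. op1 (x s * y s)) n"

definition dist_counted :: "nat \<Rightarrow> vect \<Rightarrow> vect \<Rightarrow> real counted" where
  "dist_counted n x y =
     max_counted (\<lambda>s. do { d \<leftarrow> op1 (x s - y s); op1 \<bar>d\<bar> }) (n - 1)"


section \<open>The tractability assumption\<close>

text \<open>
  \<open>lin i c \<delta>\<close> is the run of the given procedure for factor \<open>i\<close> on the cost vector \<open>c\<close> with
  accuracy \<open>\<delta>\<close>. Its operation count is \<open>O(cplx i * ln (1 / \<delta>))\<close> with constant \<open>C\<close>, for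
  \<open>\<delta> \<le> e0\<close>; a bound \<open>e0 < 1\<close> is needed because the logarithm vanishes at \<open>\<delta> = 1\<close>.
\<close>

type_synonym lin_procedure = "nat \<Rightarrow> vect \<Rightarrow> real \<Rightarrow> vect counted"

definition eps_minimizer :: "nat \<Rightarrow> vect set \<Rightarrow> vect \<Rightarrow> real \<Rightarrow> vect \<Rightarrow> bool" where
  "eps_minimizer n X c \<delta> w \<longleftrightarrow> w \<in> X \<and> (\<forall>w'\<in>X. dot n c w \<le> dot n c w' + \<delta>)"

definition tractable :: "rmdp \<Rightarrow> lin_procedure \<Rightarrow> (nat \<Rightarrow> real) \<Rightarrow> real \<Rightarrow> real \<Rightarrow> bool" where
  "tractable M lin cplx C e0 \<longleftrightarrow>
     (\<forall>i<nF M.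
        factor M i \<noteq> {} \<and> convex_vectors (factor M i) \<and> compact (factor M i) \<and>
        (\<forall>c\<in>vectors (nS M). \<forall>\<delta>>0.
           eps_minimizer (nS M) (factor M i) c \<delta> (fst (lin i c \<delta>)) \<and>
           (\<delta> \<le> e0 \<longrightarrow> real (snd (lin i c \<delta>)) \<le> C * cplx i * ln (1 / \<delta>))))"


section \<open>The algorithm (VI-PI)\<close>

text \<open>
  The update with the inner minimizations solved to accuracy \<open>\<delta>\<close>, once per factor.
\<close>

definition vi_update :: "rmdp \<Rightarrow> lin_procedure \<Rightarrow> real \<Rightarrow> vect \<Rightarrow> vect counted" where
  "vi_update M lin \<delta> v = do {
     m \<leftarrow> vect_counted (\<lambda>i. do { w \<leftarrow> lin i v \<delta>; dot_counted (nS M) w v }) (nF M);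
     vect_counted (\<lambda>s. max_counted (\<lambda>a. do {
         x \<leftarrow> sum_counted (\<lambda>i. op1 (coef M i s a * m i)) (nF M);
         y \<leftarrow> op1 (disc M * x);
         op1 (rew M s a + y)
       }) (nA M - 1)) (nS M)
   }"

text \<open>
  The inner accuracy is \<open>\<delta> = (1 - \<lambda>)\<^sup>2 \<epsilon> / 4\<close> and the stopping threshold is
  \<open>\<tau> = (1 - \<lambda>) \<epsilon> / 2\<close>. The inexact update exceeds the exact one by at most \<open>\<lambda> \<delta>\<close>, so
  the distance of successive iterates eventually drops below any number greater than
  \<open>\<lambda> \<delta> / (1 - \<lambda>) \<le> \<tau> / 2\<close>; once it is at most \<open>\<tau>\<close>, the error of the last iterate is at
  most \<open>\<lambda> (\<tau> + \<delta>) / (1 - \<lambda>) \<le> \<epsilon>\<close>.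
\<close>

definition accuracies :: "real \<Rightarrow> real \<Rightarrow> (real \<times> real) counted" where
  "accuracies l \<epsilon> = do {
     q \<leftarrow> op1 (1 - l);
     x \<leftarrow> op1 (q * \<epsilon>);
     \<tau> \<leftarrow> op1 (x / 2);
     y \<leftarrow> op1 (q * \<tau>);
     \<delta> \<leftarrow> op1 (y / 2);
     free (\<delta>, \<tau>)
   }"

text \<open>
  The loop state consists of a flag telling whether to go on and the current iterate; the
  result is \<open>None\<close> if the loop does not terminate.
\<close>

definition vi_round ::
  "rmdp \<Rightarrow> lin_procedure \<Rightarrow> real \<Rightarrow> real \<Rightarrow> bool \<times> vect \<Rightarrow> (bool \<times> vect) counted" where
  "vi_round M lin \<delta> \<tau> st = do {
     v' \<leftarrow> vi_update M lin \<delta> (snd st);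
     d \<leftarrow> dist_counted (nS M) v' (snd st);
     go \<leftarrow> op1 (\<tau> < d);
     free (go, v')
   }"

definition vi_pi :: "rmdp \<Rightarrow> lin_procedure \<Rightarrow> real \<Rightarrow> vect counted option" where
  "vi_pi M lin \<epsilon> =
     (let ((\<delta>, \<tau>), n) = accuracies (disc M) \<epsilon> in
      map_option (\<lambda>(st, k). (snd st, k))
        (while_option (\<lambda>(st, _). fst st)
           (\<lambda>c. do { st \<leftarrow> c; vi_round M lin \<delta> \<tau> st })
           ((True, \<lambda>_. 0), n)))"

end

theory Submission
  imports Defs
begin

text \<open>
  The robust Bellman operator is a contraction with modulus \<open>\<lambda>\<close>. Its fixed point \<open>v\<close> is the robust
  value because it comes with a saddle point: the minimizers of \<open>w \<mapsto> w \<bullet> v\<close> over the factors do not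
  depend on the state and the action, so they form one admissible kernel, and no policy earns more than
  \<open>v\<close> against it, while the policy greedy for \<open>v\<close> earns at least \<open>v\<close> against every kernel. Both
  comparisons come from telescoping the discounted sum of expected rewards along the law of
  \<open>(s\<^sub>t, a\<^sub>t)\<close>. The inexact iteration follows the contraction up to an error \<open>\<lambda> \<delta>\<close> per round, so it
  stops after \<open>O(log(1/\<epsilon>))\<close> rounds, and each round costs \<open>O(rSA + log(1/\<epsilon>) \<Sum> comp)\<close>.
\<close>

section \<open>The law of a state-action pair\<close>

text \<open>The one-time marginals of the trajectory measure as plain pmfs. They suffice: the return
  is a series of functions of single pairs, and each kernel of \<open>traj_step\<close> reads at
  most the preceding pair.\<close>

primrec state_action_law ::
  "nat pmf \<Rightarrow> (nat \<Rightarrow> nat pmf) \<Rightarrow> (nat \<Rightarrow> nat \<Rightarrow> nat \<Rightarrow> real) \<Rightarrow> nat \<Rightarrow> (nat \<times> nat) pmf" where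
  "state_action_law p \<pi> P 0 = bind_pmf p (act \<pi>)"
| "state_action_law p \<pi> P (Suc t) =
     bind_pmf (state_action_law p \<pi> P t) (\<lambda>x. bind_pmf (embed_pmf (P (fst x) (snd x))) (act \<pi>))"

text \<open>The coordinate at time \<open>t\<close> is decided by the first \<open>t + 1\<close>
  kernels, so the projective limit reduces to their composition \<open>IT.C 0 (Suc t)\<close>;
  integrating out the last kernel again and again gives the recursion of
  \<open>state_action_law\<close>.\<close>

lemma sets_trajectories: "sets (trajectories p \<pi> P) = sets (PiM UNIV (\<lambda>_. count_space UNIV))"
  and distr_trajectories:
    "distr (trajectories p \<pi> P) (count_space UNIV) (\<lambda>\<omega>. \<omega> t) = measure_pmf (state_action_law p \<pi> P t)"
proof -
  interpret IT: Ionescu_Tulcea "traj_step p \<pi> P" "\<lambda>_. count_space UNIV"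
    by (rule Ionescu_Tulcea_traj_step)
  let ?M = "\<lambda>_::nat. count_space UNIV :: (nat \<times> nat) measure"
  show sets: "sets (trajectories p \<pi> P) = sets (PiM UNIV ?M)"
    by (simp add: trajectories_def)
  have u: "(\<lambda>x. undefined) \<in> space (PiM {0..<0} ?M)"
    by (simp add: space_PiM)
  \<comment> \<open>\<open>IT.C 0 (Suc n)\<close> appends to \<open>IT.C 0 n\<close> one coordinate
    drawn from \<open>traj_step\<close> at \<open>n\<close>.\<close>
  have step: "(\<integral>\<^sup>+\<omega>. f (\<omega> n) \<partial>IT.C 0 (Suc n) (\<lambda>x. undefined))
      = (\<integral>\<^sup>+\<omega>. \<integral>\<^sup>+x. f x \<partial>traj_step p \<pi> P n \<omega> \<partial>IT.C 0 n (\<lambda>x. undefined))" for f :: "nat \<times> nat \<Rightarrow> ennreal" and n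
  proof -
    have m: "(\<lambda>\<omega>. f (\<omega> n)) \<in> borel_measurable (PiM {0..<Suc n} ?M)"
      by (rule measurable_compose[OF measurable_component_singleton]) auto
    have "(\<integral>\<^sup>+\<omega>. f (\<omega> n) \<partial>IT.C 0 (Suc n) (\<lambda>x. undefined))
       = (\<integral>\<^sup>+\<omega>. \<integral>\<^sup>+x. f (x n) \<partial>IT.eP n \<omega> \<partial>IT.C 0 n (\<lambda>x. undefined))"
      using m IT.measurable_eP[of n] IT.sets_C[OF u, of n]
      by (subst IT.C.simps, subst nn_integral_bind[where B="PiM {0..<Suc n} ?M"])
         (auto cong: measurable_cong_sets)
    also have "\<dots> = (\<integral>\<^sup>+\<omega>. \<integral>\<^sup>+x. f x \<partial>traj_step p \<pi> P n \<omega> \<partial>IT.C 0 n (\<lambda>x. undefined))"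
      using IT.space_C[OF u, of n] m by (intro nn_integral_cong) (simp add: IT.nn_integral_eP)
    finally show ?thesis .
  qed
  \<comment> \<open>\<open>f\<close> stays arbitrary because the induction hypothesis is applied to
    the one-step expectation of \<open>f\<close>.\<close>
  have marg: "(\<integral>\<^sup>+\<omega>. f (\<omega> n) \<partial>IT.C 0 (Suc n) (\<lambda>x. undefined))
      = (\<integral>\<^sup>+x. f x \<partial>state_action_law p \<pi> P n)" for f :: "nat \<times> nat \<Rightarrow> ennreal" and n
  proof (induction n arbitrary: f)
    case 0
    have "prob_space (IT.C 0 0 (\<lambda>x. undefined))"
      by (rule IT.prob_space_C) (rule u)
    then show ?case
      unfolding step by (simp add: prob_space.emeasure_space_1 del: IT.C.simps)
  next
    case (Suc n)
    show ?case
      using Suc.IH[of "\<lambda>x. \<integral>\<^sup>+y. f y \<partial>bind_pmf (embed_pmf (P (fst x) (snd x))) (act \<pi>)"]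
      unfolding step[where f=f and n="Suc n"] by (simp del: IT.C.simps)
  qed
  show "distr (trajectories p \<pi> P) (count_space UNIV) (\<lambda>\<omega>. \<omega> t) = measure_pmf (state_action_law p \<pi> P t)"
  proof (rule measure_eqI)
    fix B :: "(nat \<times> nat) set"
    \<comment> \<open>The event that \<open>\<omega> t\<close> lies in \<open>B\<close> is the
      cylinder over \<open>?X\<close>, a form to which \<open>IT.lim\<close> applies.\<close>
    let ?J = "{0..<Suc t}" and ?X = "{\<omega> \<in> space (PiM {0..<Suc t} ?M). \<omega> t \<in> B}"
    have X: "?X \<in> sets (PiM ?J ?M)"
      by measurable
    have mt: "(\<lambda>\<omega>. \<omega> t) \<in> measurable (trajectories p \<pi> P) (count_space UNIV)"
      by (simp add: measurable_cong_sets[OF sets refl])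
    have "emeasure (distr (trajectories p \<pi> P) (count_space UNIV) (\<lambda>\<omega>. \<omega> t)) B
        = emeasure (trajectories p \<pi> P) (prod_emb UNIV ?M ?J ?X)"
      using mt by (subst emeasure_distr)
        (auto intro!: arg_cong[where f="emeasure _"] simp: prod_emb_def space_PiM sets_eq_imp_space_eq[OF sets])
    also have "\<dots> = emeasure (IT.CI ?J) ?X"
      unfolding trajectories_def by (rule IT.lim) (auto intro: X)
    also have "\<dots> = emeasure (IT.C 0 (Suc t) (\<lambda>x. undefined)) ?X"
      by (subst IT.emeasure_CI[OF subset_refl X], subst prod_emb_id) (auto simp: space_PiM)
    also have "\<dots> = (\<integral>\<^sup>+\<omega>. indicator B (\<omega> t) \<partial>IT.C 0 (Suc t) (\<lambda>x. undefined))"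
      using X IT.sets_C[OF u, of "Suc t"] IT.space_C[OF u, of "Suc t"]
      by (subst nn_integral_indicator[symmetric])
         (auto simp del: IT.C.simps nn_integral_indicator intro!: nn_integral_cong split: split_indicator)
    also have "\<dots> = emeasure (state_action_law p \<pi> P t) B"
      by (simp add: marg del: IT.C.simps)
    finally show "emeasure (distr (trajectories p \<pi> P) (count_space UNIV) (\<lambda>\<omega>. \<omega> t)) B
      = emeasure (state_action_law p \<pi> P t) B" .
  qed simp
qed

lemma measurable_trajectories [measurable]:
  "(\<lambda>\<omega>. \<omega> t) \<in> measurable (trajectories p \<pi> P) (count_space UNIV)"
  by (simp add: measurable_cong_sets[OF sets_trajectories refl])

lemma prob_space_trajectories: "prob_space (trajectories p \<pi> P)"
  using measurable_trajectories[of 0 p \<pi> P]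
proof (rule prob_space_distrD)
  show "prob_space (distr (trajectories p \<pi> P) (count_space UNIV) (\<lambda>\<omega>. \<omega> 0))"
    by (simp add: distr_trajectories prob_space_measure_pmf)
qed

lemma AE_trajectories: "AE \<omega> in trajectories p \<pi> P. \<omega> t \<in> set_pmf (state_action_law p \<pi> P t)"
proof -
  have "AE x in distr (trajectories p \<pi> P) (count_space UNIV) (\<lambda>\<omega>. \<omega> t).
          x \<in> set_pmf (state_action_law p \<pi> P t)"
    unfolding distr_trajectories by (rule AE_measure_pmf)
  then show ?thesis
    by (subst (asm) AE_distr_iff) auto
qed

lemma integral_trajectories:
  fixes h :: "nat \<times> nat \<Rightarrow> real"
  shows "(\<integral>\<omega>. h (\<omega> t) \<partial>trajectories p \<pi> P) = measure_pmf.expectation (state_action_law p \<pi> P t) h"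
  unfolding distr_trajectories[symmetric] by (subst integral_distr) auto

section \<open>Discounted sums along a controlled Markov chain\<close>

text \<open>\<open>embed_pmf\<close> reproduces \<open>f\<close> once \<open>f\<close> is
  nonnegative with total mass one over all of \<open>nat\<close>; the finite support turns that
  integral into the given sum.\<close>

lemma pmf_embed_pmf_finite_support:
  fixes f :: "nat \<Rightarrow> real"
  assumes "\<And>x. 0 \<le> f x" and "\<And>x. n \<le> x \<Longrightarrow> f x = 0" and "(\<Sum>x<n. f x) = 1"
  shows "pmf (embed_pmf f) x = f x"
proof (rule pmf_embed_pmf[OF assms(1)])
  have "(\<integral>\<^sup>+x. f x \<partial>count_space UNIV) = (\<Sum>x<n. ennreal (f x))"
    using assms by (subst nn_integral_count_space'[of "{..<n}"]) (auto simp: not_less)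
  then show "(\<integral>\<^sup>+x. f x \<partial>count_space UNIV) = 1"
    using assms by (simp add: sum_nonneg)
qed

text \<open>The conditions concern only the grid \<open>{..<n} \<times> {..<m}\<close>. A chain
  started at states below \<open>n\<close> never leaves it (\<open>set_law\<close>), so all
  expectations become finite sums.\<close>

locale controlled_chain =
  fixes n m :: nat and \<pi> :: "nat \<Rightarrow> nat pmf" and P :: "nat \<Rightarrow> nat \<Rightarrow> nat \<Rightarrow> real"
  assumes actions: "\<And>s. s < n \<Longrightarrow> set_pmf (\<pi> s) \<subseteq> {..<m}"
    and P_nonneg: "\<And>s a s'. s < n \<Longrightarrow> a < m \<Longrightarrow> 0 \<le> P s a s'"
    and P_support: "\<And>s a s'. s < n \<Longrightarrow> a < m \<Longrightarrow> n \<le> s' \<Longrightarrow> P s a s' = 0"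
    and P_sum: "\<And>s a. s < n \<Longrightarrow> a < m \<Longrightarrow> (\<Sum>s'<n. P s a s') = 1"
begin

abbreviation law :: "nat pmf \<Rightarrow> nat \<Rightarrow> (nat \<times> nat) pmf" where
  "law p \<equiv> state_action_law p \<pi> P"

lemma pmf_embed: "s < n \<Longrightarrow> a < m \<Longrightarrow> pmf (embed_pmf (P s a)) s' = P s a s'"
  by (rule pmf_embed_pmf_finite_support[of _ n]) (auto simp: P_nonneg P_support P_sum)

lemma set_embed: "s < n \<Longrightarrow> a < m \<Longrightarrow> set_pmf (embed_pmf (P s a)) \<subseteq> {..<n}"
  using P_support[of s a] by (auto simp: set_pmf_iff pmf_embed) (metis not_le)

lemma set_act: "s < n \<Longrightarrow> set_pmf (act \<pi> s) \<subseteq> {..<n} \<times> {..<m}"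
  using actions by (auto simp: act_def)

lemma finite_set_act: "s < n \<Longrightarrow> finite (set_pmf (act \<pi> s))"
  using set_act by (rule finite_subset) auto

lemma expectation_act:
  fixes h :: "nat \<times> nat \<Rightarrow> real"
  assumes "s < n"
  shows "measure_pmf.expectation (act \<pi> s) h = (\<Sum>a<m. pmf (\<pi> s) a * h (s, a))"
  unfolding act_def using actions[OF assms]
  by (simp, subst integral_measure_pmf[of "{..<m}"]) auto

lemma set_law:
  assumes "set_pmf p \<subseteq> {..<n}"
  shows "set_pmf (law p t) \<subseteq> {..<n} \<times> {..<m}"
proof (induction t)
  case 0
  then show ?case using assms set_act by fastforce
next
  case (Suc t)
  show ?case
  proof
    fix y assume "y \<in> set_pmf (law p (Suc t))"
    then obtain x s' where "x \<in> set_pmf (law p t)" "s' \<in> set_pmf (embed_pmf (P (fst x) (snd x)))"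
      "y \<in> set_pmf (act \<pi> s')"
      by auto
    with Suc set_embed[of "fst x" "snd x"] set_act[of s'] show "y \<in> {..<n} \<times> {..<m}"
      by (cases x) auto
  qed
qed

lemma expectation_law:
  fixes h :: "nat \<times> nat \<Rightarrow> real"
  assumes "set_pmf p \<subseteq> {..<n}"
  shows "measure_pmf.expectation (law p t) h = (\<Sum>x\<in>{..<n} \<times> {..<m}. pmf (law p t) x * h x)"
  using set_law[OF assms, of t] by (subst integral_measure_pmf[of "{..<n} \<times> {..<m}"]) auto

text \<open>Conditioning on the pair at time \<open>t\<close> moves the transition from the law to
  \<open>h\<close>, so that expectations at successive times can be compared under one law.\<close>

lemma expectation_law_Suc:
  fixes h :: "nat \<times> nat \<Rightarrow> real"
  assumes "set_pmf p \<subseteq> {..<n}"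
  shows "measure_pmf.expectation (law p (Suc t)) h
    = measure_pmf.expectation (law p t)
        (\<lambda>(s, a). \<Sum>s'<n. P s a s' * (\<Sum>a'<m. pmf (\<pi> s') a' * h (s', a')))"
proof -
  let ?G = "{..<n} \<times> {..<m}"
  let ?K = "\<lambda>x. bind_pmf (embed_pmf (P (fst x) (snd x))) (act \<pi>)"
  have K: "set_pmf (?K x) \<subseteq> ?G" if "x \<in> ?G" for x
    using that set_embed[of "fst x" "snd x"] set_act by fastforce
  have "measure_pmf.expectation (?K x) h
      = (\<Sum>s'<n. P (fst x) (snd x) s' * (\<Sum>a'<m. pmf (\<pi> s') a' * h (s', a')))" if "x \<in> ?G" for x
    using that set_embed[of "fst x" "snd x"] set_act
    by (subst pmf_expectation_bind[where A="{..<n}"])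
       (auto simp: pmf_embed expectation_act finite_set_act)
  moreover have "measure_pmf.expectation (law p (Suc t)) h
      = (\<Sum>x\<in>?G. pmf (law p t) x *\<^sub>R measure_pmf.expectation (?K x) h)"
    unfolding state_action_law.simps
    by (rule pmf_expectation_bind) (use K set_law[OF assms] finite_subset in \<open>blast+\<close>)
  ultimately show ?thesis
    by (simp add: expectation_law[OF assms] case_prod_beta cong: sum.cong)
qed

lemma expectation_law_bounded:
  fixes h :: "nat \<times> nat \<Rightarrow> real"
  assumes "set_pmf p \<subseteq> {..<n}" and "\<And>s a. s < n \<Longrightarrow> a < m \<Longrightarrow> \<bar>h (s, a)\<bar> \<le> b"
  shows "\<bar>measure_pmf.expectation (law p t) h\<bar> \<le> b"
proof -
  let ?G = "{..<n} \<times> {..<m}"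
  have "\<bar>measure_pmf.expectation (law p t) h\<bar> \<le> (\<Sum>x\<in>?G. \<bar>pmf (law p t) x * h x\<bar>)"
    unfolding expectation_law[OF assms(1)] by (rule sum_abs)
  also have "\<dots> \<le> (\<Sum>x\<in>?G. pmf (law p t) x * b)"
    using assms(2) by (intro sum_mono) (auto simp: abs_mult intro!: mult_left_mono)
  also have "\<dots> = b"
    using set_law[OF assms(1), of t] by (simp add: sum_distrib_right[symmetric] sum_pmf_eq_1)
  finally show ?thesis .
qed

lemma summable_discounted:
  fixes h :: "nat \<times> nat \<Rightarrow> real" and l :: real
  assumes "set_pmf p \<subseteq> {..<n}" and "0 \<le> l" and "l < 1"
  shows "summable (\<lambda>t. l ^ t * measure_pmf.expectation (law p t) h)"
proof (rule summable_comparison_test[where g="\<lambda>t. (\<Sum>x\<in>{..<n} \<times> {..<m}. \<bar>h x\<bar>) * l ^ t"])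
  have "\<bar>measure_pmf.expectation (law p t) h\<bar> \<le> (\<Sum>x\<in>{..<n} \<times> {..<m}. \<bar>h x\<bar>)" for t
    using assms(1) by (rule expectation_law_bounded) (rule member_le_sum, auto)
  then show "\<exists>N. \<forall>t\<ge>N. norm (l ^ t * measure_pmf.expectation (law p t) h)
      \<le> (\<Sum>x\<in>{..<n} \<times> {..<m}. \<bar>h x\<bar>) * l ^ t"
    using assms(2) by (intro exI[of _ 0]) (auto simp: abs_mult mult.commute intro!: mult_left_mono)
  show "summable (\<lambda>t. (\<Sum>x\<in>{..<n} \<times> {..<m}. \<bar>h x\<bar>) * l ^ t)"
    using assms(2,3) by (intro summable_mult summable_geometric) auto
qed

text \<open>With the one-step lookahead \<open>q\<close> of \<open>u\<close>, the expected reward at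
  time \<open>t\<close> is at least \<open>E t q - l * E (Suc t) q\<close>. Weighted by
  \<open>l ^ t\<close> these differences telescope to \<open>E 0 q\<close>, the policy average of
  \<open>q\<close> at \<open>s\<close>, which is at least \<open>u s\<close>.\<close>

lemma discounted_sum_ge:
  fixes r :: "nat \<Rightarrow> nat \<Rightarrow> real" and u :: "nat \<Rightarrow> real" and l :: real
  assumes s: "s < n" and l: "0 \<le> l" "l < 1"
    and sub: "\<And>s. s < n \<Longrightarrow> u s \<le> (\<Sum>a<m. pmf (\<pi> s) a * (r s a + l * (\<Sum>s'<n. P s a s' * u s')))"
  shows "u s \<le> (\<Sum>t. l ^ t * measure_pmf.expectation (law (return_pmf s) t) (\<lambda>(s, a). r s a))"
proof -
  define q where "q = (\<lambda>(s, a). r s a + l * (\<Sum>s'<n. P s a s' * u s'))"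
  define E where "E t h = measure_pmf.expectation (law (return_pmf s) t) h"
    for t and h :: "nat \<times> nat \<Rightarrow> real"
  have p: "set_pmf (return_pmf s) \<subseteq> {..<n}"
    using s by simp
  let ?w = "\<lambda>s'. \<Sum>a'<m. pmf (\<pi> s') a' * q (s', a')"
  have w: "u s' \<le> ?w s'" if "s' < n" for s'
    using sub[OF that] by (simp add: q_def)
  \<comment> \<open>Since \<open>q\<close> is \<open>r\<close> plus \<open>l\<close> times the
    expectation of \<open>u\<close>, replacing \<open>u\<close> by the larger \<open>?w\<close> in
    the subtracted term leaves at most \<open>r\<close>.\<close>
  have step: "E t q - l * E (Suc t) q \<le> E t (\<lambda>(s, a). r s a)" for t
  proof -
    have "q x - l * (\<Sum>s'<n. P (fst x) (snd x) s' * ?w s') \<le> r (fst x) (snd x)"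
      if "x \<in> {..<n} \<times> {..<m}" for x
    proof -
      have "(\<Sum>s'<n. P (fst x) (snd x) s' * u s') \<le> (\<Sum>s'<n. P (fst x) (snd x) s' * ?w s')"
        using that by (intro sum_mono mult_left_mono) (auto simp: w P_nonneg)
      from mult_left_mono[OF this l(1)] show ?thesis
        by (simp add: q_def case_prod_beta)
    qed
    from mult_left_mono[OF this pmf_nonneg]
    have "(\<Sum>x\<in>{..<n} \<times> {..<m}. pmf (law (return_pmf s) t) x *
              (q x - l * (\<Sum>s'<n. P (fst x) (snd x) s' * ?w s')))
        \<le> E t (\<lambda>(s, a). r s a)"
      unfolding E_def expectation_law[OF p] case_prod_beta by (rule sum_mono)
    moreover have "(\<Sum>x\<in>{..<n} \<times> {..<m}. pmf (law (return_pmf s) t) x *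
              (q x - l * (\<Sum>s'<n. P (fst x) (snd x) s' * ?w s'))) = E t q - l * E (Suc t) q"
      unfolding E_def expectation_law_Suc[OF p] expectation_law[OF p, of t]
      by (simp add: case_prod_beta right_diff_distrib sum_subtractf sum_distrib_left mult_ac)
    ultimately show ?thesis by simp
  qed
  have partial: "E 0 q - l ^ N * E N q \<le> (\<Sum>t<N. l ^ t * E t (\<lambda>(s, a). r s a))" for N
  proof (induction N)
    case (Suc N)
    have "l ^ N * (E N q - l * E (Suc N) q) \<le> l ^ N * E N (\<lambda>(s, a). r s a)"
      using step l(1) by (intro mult_left_mono) auto
    with Suc show ?case by (simp add: algebra_simps)
  qed simp
  \<comment> \<open>The remainder \<open>l ^ N * E N q\<close> vanishes as the general term of a
    convergent series.\<close>
  have "(\<lambda>N. E 0 q - l ^ N * E N q) \<longlonglongrightarrow> E 0 q - 0"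
    unfolding E_def using summable_LIMSEQ_zero[OF summable_discounted[OF p l]]
    by (intro tendsto_diff tendsto_const) 
  moreover have "(\<lambda>N. \<Sum>t<N. l ^ t * E t (\<lambda>(s, a). r s a)) \<longlonglongrightarrow> (\<Sum>t. l ^ t * E t (\<lambda>(s, a). r s a))"
    unfolding E_def by (intro summable_LIMSEQ summable_discounted p l)
  ultimately have "E 0 q - 0 \<le> (\<Sum>t. l ^ t * E t (\<lambda>(s, a). r s a))"
    using partial by (intro LIMSEQ_le) auto
  moreover have "E 0 q = ?w s"
    unfolding E_def by (simp add: bind_return_pmf expectation_act[OF s])
  ultimately show ?thesis
    using w[OF s] by (simp add: E_def)
qed

text \<open>Negating \<open>u\<close> and \<open>r\<close> reduces this to
  \<open>discounted_sum_ge\<close>, which puts no sign condition on the rewards.\<close>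

lemma discounted_sum_le:
  fixes r :: "nat \<Rightarrow> nat \<Rightarrow> real" and u :: "nat \<Rightarrow> real" and l :: real
  assumes s: "s < n" and l: "0 \<le> l" "l < 1"
    and super: "\<And>s. s < n \<Longrightarrow> (\<Sum>a<m. pmf (\<pi> s) a * (r s a + l * (\<Sum>s'<n. P s a s' * u s'))) \<le> u s"
  shows "(\<Sum>t. l ^ t * measure_pmf.expectation (law (return_pmf s) t) (\<lambda>(s, a). r s a)) \<le> u s"
proof -
  have "- u s \<le> (\<Sum>t. l ^ t * measure_pmf.expectation (law (return_pmf s) t) (\<lambda>(s, a). - r s a))"
  proof (rule discounted_sum_ge[OF s l])
    fix s assume "s < n"
    have neg: "(\<Sum>s'<n. P s a s' * - u s') = - (\<Sum>s'<n. P s a s' * u s')" for a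
      by (simp add: sum_negf)
    have "pmf (\<pi> s) a * (- r s a + l * (\<Sum>s'<n. P s a s' * - u s'))
        = - (pmf (\<pi> s) a * (r s a + l * (\<Sum>s'<n. P s a s' * u s')))" for a
      unfolding neg by (simp add: algebra_simps)
    then have "(\<Sum>a<m. pmf (\<pi> s) a * (- r s a + l * (\<Sum>s'<n. P s a s' * - u s')))
        = - (\<Sum>a<m. pmf (\<pi> s) a * (r s a + l * (\<Sum>s'<n. P s a s' * u s')))"
      by (simp only: sum_negf)
    with super[OF \<open>s < n\<close>]
    show "- u s \<le> (\<Sum>a<m. pmf (\<pi> s) a * (- r s a + l * (\<Sum>s'<n. P s a s' * - u s')))"
      by simp
  qed
  also have "\<dots> = - (\<Sum>t. l ^ t * measure_pmf.expectation (law (return_pmf s) t) (\<lambda>(s, a). r s a))"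
  proof -
    have "measure_pmf.expectation (law (return_pmf s) t) (\<lambda>(s, a). - r s a)
        = - measure_pmf.expectation (law (return_pmf s) t) (\<lambda>(s, a). r s a)" for t
      unfolding case_prod_beta by (rule Bochner_Integration.integral_minus)
    moreover have "summable (\<lambda>t. l ^ t * measure_pmf.expectation (law (return_pmf s) t) (\<lambda>(s, a). r s a))"
      by (rule summable_discounted) (use s l in auto)
    ultimately show ?thesis by (simp only: mult_minus_right suminf_minus)
  qed
  finally show ?thesis by simp
qed

text \<open>Integral and series may be exchanged because the terms are dominated by a geometric
  series almost surely.\<close>

lemma expected_return_eq:
  assumes p: "set_pmf p \<subseteq> {..<n}" and l: "0 < disc M" "disc M < 1"
  shows "expected_return M p \<pi> P
    = (\<Sum>t. disc M ^ t * measure_pmf.expectation (law p t) (\<lambda>(s, a). rew M s a))"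
proof -
  let ?T = "trajectories p \<pi> P" and ?h = "\<lambda>t \<omega>. disc M ^ t * rew M (fst (\<omega> t)) (snd (\<omega> t))"
  \<comment> \<open>A crude bound on the rewards of the grid. Off the grid \<open>rew M\<close> is
    arbitrary, hence the domination holds only almost everywhere.\<close>
  define b where "b = (\<Sum>x\<in>{..<n} \<times> {..<m}. \<bar>rew M (fst x) (snd x)\<bar>)"
  interpret prob_space ?T by (rule prob_space_trajectories)
  have "AE \<omega> in ?T. \<omega> t \<in> {..<n} \<times> {..<m}" for t
    using AE_trajectories[of t p \<pi> P] by eventually_elim (use set_law[OF p, of t] in blast)
  then have "AE \<omega> in ?T. \<forall>t. \<omega> t \<in> {..<n} \<times> {..<m}"
    unfolding AE_all_countable ..
  then have bd: "AE \<omega> in ?T. \<forall>t. norm (?h t \<omega>) \<le> b * disc M ^ t"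
  proof eventually_elim
    case (elim \<omega>)
    have "\<bar>rew M (fst (\<omega> t)) (snd (\<omega> t))\<bar> \<le> b" for t
      unfolding b_def using elim by (intro member_le_sum) auto
    with l show ?case by (auto simp: abs_mult mult.commute intro!: mult_right_mono)
  qed
  have geo: "summable (\<lambda>t. b * disc M ^ t)"
    using l by (intro summable_mult summable_geometric) auto
  have meas: "?h t \<in> borel_measurable ?T" for t
    by (rule measurable_compose[OF measurable_trajectories[of t], of "\<lambda>x. disc M ^ t * rew M (fst x) (snd x)"]) simp
  have int: "integrable ?T (?h t)" for t
    by (rule integrable_const_bound[OF _ meas, of _ "b * disc M ^ t"]) (use bd in \<open>auto elim: AE_mp\<close>)
  have "expected_return M p \<pi> P = (\<Sum>t. \<integral>\<omega>. ?h t \<omega> \<partial>?T)"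
    unfolding expected_return_def
  proof (rule integral_suminf)
    show "AE \<omega> in ?T. summable (\<lambda>t. norm (?h t \<omega>))"
      using bd by eventually_elim (rule summable_comparison_test'[OF geo, of 0], simp)
    have "norm (\<integral>\<omega>. norm (?h t \<omega>) \<partial>?T) \<le> b * disc M ^ t" for t
    proof -
      have "(\<integral>\<omega>. norm (?h t \<omega>) \<partial>?T) \<le> b * disc M ^ t"
        using bd by (intro integral_le_const integrable_norm int) (auto elim: AE_mp)
      then show ?thesis by simp
    qed
    then show "summable (\<lambda>t. \<integral>\<omega>. norm (?h t \<omega>) \<partial>?T)"
      by (intro summable_comparison_test'[OF geo, of 0]) auto
  qed (rule int)
  also have "\<dots> = (\<Sum>t. disc M ^ t * measure_pmf.expectation (law p t) (\<lambda>(s, a). rew M s a))"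
    using integral_trajectories[where h="\<lambda>(s, a). rew M s a" and p=p and \<pi>=\<pi> and P=P] by (simp add: case_prod_beta)
  finally show ?thesis .
qed

end

section \<open>The robust Bellman operator\<close>

lemma compact_dot_attains_inf:
  assumes "compact X" and "X \<noteq> {}"
  obtains w where "w \<in> X" and "\<And>w'. w' \<in> X \<Longrightarrow> dot n w v \<le> dot n w' v"
proof -
  have "continuous_on X (\<lambda>w. dot n w v)"
    unfolding dot_def
    by (intro continuous_intros continuous_on_subset[OF continuous_on_product_coordinates]) auto
  from continuous_attains_inf[OF assms this] that show ?thesis by blast
qed

lemma dot_commute: "dot n x y = dot n y x"
  by (simp add: dot_def mult.commute)

text \<open>Probability weights pass a constant shift on unchanged. Carrying the shift
  \<open>b\<close> through the monotonicity lemmas serves twice: used in both directions it gives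
  the contraction, and with \<open>b = \<delta>\<close> it propagates the error of the inner
  minimizations.\<close>

lemma dot_mono:
  assumes "w \<in> prob_vectors n" and "\<And>s. s < n \<Longrightarrow> u s \<le> v s + b"
  shows "dot n w u \<le> dot n w v + b"
proof -
  have "dot n w u \<le> (\<Sum>s<n. w s * (v s + b))"
    unfolding dot_def using assms by (intro sum_mono mult_left_mono) (auto simp: prob_vectors_def)
  also have "\<dots> = dot n w v + (\<Sum>s<n. w s) * b"
    by (simp add: dot_def distrib_left sum.distrib sum_distrib_right)
  finally show ?thesis using assms by (simp add: prob_vectors_def)
qed

text \<open>\<open>m\<close> holds one number per factor, so that exact minima, approximate minima
  and the products with a fixed \<open>W\<close> can all be inserted.\<close>

definition q_value :: "rmdp \<Rightarrow> (nat \<Rightarrow> real) \<Rightarrow> nat \<Rightarrow> nat \<Rightarrow> real" where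
  "q_value M m s a = rew M s a + disc M * (\<Sum>i<nF M. coef M i s a * m i)"

definition max_q :: "rmdp \<Rightarrow> (nat \<Rightarrow> real) \<Rightarrow> nat \<Rightarrow> real" where
  "max_q M m s = (MAX a\<in>{..<nA M}. q_value M m s a)"

definition worst :: "rmdp \<Rightarrow> nat \<Rightarrow> vect \<Rightarrow> real" where
  "worst M i v = (INF w\<in>factor M i. dot (nS M) w v)"

text \<open>The value 0 outside the states makes the range finite, so the image of any function is
  bounded.\<close>

definition bellman :: "rmdp \<Rightarrow> vect \<Rightarrow> vect" where
  "bellman M v s = (if s < nS M then max_q M (\<lambda>i. worst M i v) s else 0)"

locale compact_rmdp =
  fixes M :: rmdp
  assumes rect: "r_rectangular_mdp M"
    and factor_nonempty: "\<And>i. i < nF M \<Longrightarrow> factor M i \<noteq> {}"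
    and factor_compact: "\<And>i. i < nF M \<Longrightarrow> compact (factor M i)"
begin

section \<open>Shift monotonicity and contraction of the Bellman operator\<close>

lemma sizes: "0 < nS M" "0 < nA M" "0 < nF M"
  and disc: "0 < disc M" "disc M < 1"
  and rew_nonneg: "s < nS M \<Longrightarrow> a < nA M \<Longrightarrow> 0 \<le> rew M s a"
  and coef_nonneg: "s < nS M \<Longrightarrow> a < nA M \<Longrightarrow> i < nF M \<Longrightarrow> 0 \<le> coef M i s a"
  and coef_sum: "s < nS M \<Longrightarrow> a < nA M \<Longrightarrow> (\<Sum>i<nF M. coef M i s a) = 1"
  and factor_prob: "i < nF M \<Longrightarrow> factor M i \<subseteq> prob_vectors (nS M)"
  using rect by (auto simp: r_rectangular_mdp_def)

lemma worst_attained: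
  assumes "i < nF M"
  obtains w where "w \<in> factor M i" and "dot (nS M) w v = worst M i v"
proof -
  from compact_dot_attains_inf[OF factor_compact[OF assms] factor_nonempty[OF assms], of "nS M" v]
  obtain w where w: "w \<in> factor M i" "\<And>w'. w' \<in> factor M i \<Longrightarrow> dot (nS M) w v \<le> dot (nS M) w' v"
    by blast
  then have "dot (nS M) w v = worst M i v"
    unfolding worst_def by (intro cInf_eq_minimum[symmetric]) auto
  with w(1) that show ?thesis by blast
qed

lemma worst_le:
  assumes "i < nF M" and "w \<in> factor M i"
  shows "worst M i v \<le> dot (nS M) w v"
proof -
  from compact_dot_attains_inf[OF factor_compact[OF assms(1)] factor_nonempty[OF assms(1)], of "nS M" v]
  obtain w0 where "\<And>w'. w' \<in> factor M i \<Longrightarrow> dot (nS M) w0 v \<le> dot (nS M) w' v"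
    by blast
  then show ?thesis
    unfolding worst_def using assms(2) by (intro cINF_lower bdd_belowI2[of _ "dot (nS M) w0 v"]) auto
qed

lemma worst_mono:
  assumes i: "i < nF M" and "\<And>s. s < nS M \<Longrightarrow> u s \<le> v s + b"
  shows "worst M i u \<le> worst M i v + b"
proof -
  obtain w where w: "w \<in> factor M i" "dot (nS M) w v = worst M i v"
    using worst_attained[OF i] by blast
  have "worst M i u \<le> dot (nS M) w u"
    by (rule worst_le[OF i w(1)])
  also have "\<dots> \<le> dot (nS M) w v + b"
    using w(1) factor_prob[OF i] assms(2) by (intro dot_mono) auto
  finally show ?thesis using w(2) by simp
qed

lemma q_value_mono:
  assumes s: "s < nS M" "a < nA M" and "\<And>i. i < nF M \<Longrightarrow> x i \<le> y i + b"
  shows "q_value M x s a \<le> q_value M y s a + disc M * b"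
proof -
  have "(\<Sum>i<nF M. coef M i s a * x i) \<le> (\<Sum>i<nF M. coef M i s a * (y i + b))"
    using assms by (intro sum_mono mult_left_mono) (auto simp: coef_nonneg)
  also have "\<dots> = (\<Sum>i<nF M. coef M i s a * y i) + b"
    by (simp add: distrib_left sum.distrib sum_distrib_right[symmetric] coef_sum[OF s])
  finally show ?thesis
    using disc by (simp add: q_value_def distrib_left[symmetric] mult_left_mono)
qed

lemma max_q_ge: "a < nA M \<Longrightarrow> q_value M m s a \<le> max_q M m s"
  unfolding max_q_def by (rule Max_ge) auto

lemma max_q_attained:
  obtains a where "a < nA M" and "max_q M m s = q_value M m s a"
proof -
  have "max_q M m s \<in> q_value M m s ` {..<nA M}"
    unfolding max_q_def using sizes by (intro Max_in) auto
  with that show ?thesis by auto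
qed

lemma max_q_mono:
  assumes "s < nS M" and "\<And>i. i < nF M \<Longrightarrow> x i \<le> y i + b"
  shows "max_q M x s \<le> max_q M y s + disc M * b"
proof -
  obtain a where a: "a < nA M" "max_q M x s = q_value M x s a"
    by (rule max_q_attained)
  then show ?thesis
    using q_value_mono[OF assms(1) a(1) assms(2)] max_q_ge[OF a(1), of y s] by fastforce
qed

lemma bellman_mono:
  assumes "s < nS M" and "\<And>s. s < nS M \<Longrightarrow> u s \<le> v s + b"
  shows "bellman M u s \<le> bellman M v s + disc M * b"
  using assms by (simp add: bellman_def max_q_mono worst_mono)

text \<open>This is \<open>bellman_mono\<close> in both directions. It covers every
  \<open>s\<close>, as the supremum metric in \<open>bellman_fixpoint\<close> requires; outside the
  states the left side is 0.\<close>

lemma bellman_contraction: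
  assumes "\<And>s. s < nS M \<Longrightarrow> \<bar>u s - v s\<bar> \<le> b" and "0 \<le> b"
  shows "\<bar>bellman M u s - bellman M v s\<bar> \<le> disc M * b"
proof (cases "s < nS M")
  case True
  have "bellman M u s \<le> bellman M v s + disc M * b" "bellman M v s \<le> bellman M u s + disc M * b"
    using assms(1) by (intro bellman_mono[OF True]; fastforce simp: abs_le_iff)+
  then show ?thesis by linarith
next
  case False
  then show ?thesis using assms(2) disc by (simp add: bellman_def)
qed

text \<open>
  The type \<open>nat\<close> carries no metric in the library, hence the detour through \<open>nat discrete\<close> to
  apply Banach's fixed point theorem to bounded continuous functions.
\<close>

lemma bellman_fixpoint:
  obtains v where "bellman M v = v"
proof -
  have fin: "finite (range (bellman M v))" for v
    by (rule finite_subset[of _ "insert 0 (bellman M v ` {..<nS M})"]) (auto simp: bellman_def)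
  have "bounded (range (\<lambda>x. bellman M v (of_discrete x)))" for v
    by (rule bounded_subset[OF finite_imp_bounded[OF fin[of v]]]) auto
  then have bcont: "(\<lambda>x. bellman M v (of_discrete x)) \<in> bcontfun" for v
    by (simp add: bcontfun_def continuous_on_open_vimage open_discrete)
  define F where "F v = Bcontfun (\<lambda>x. bellman M (\<lambda>s. apply_bcontfun v (discrete s)) (of_discrete x))"
    for v :: "nat discrete \<Rightarrow>\<^sub>C real"
  have F: "apply_bcontfun (F v) x = bellman M (\<lambda>s. apply_bcontfun v (discrete s)) (of_discrete x)" for v x
    unfolding F_def by (simp only: Bcontfun_inverse[OF bcont])
  have "dist (F u) (F v) \<le> disc M * dist u v" for u v
  proof (rule dist_bound)
    fix x
    show "dist (apply_bcontfun (F u) x) (apply_bcontfun (F v) x) \<le> disc M * dist u v"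
      unfolding F dist_real_def
      using dist_bounded[of u _ v] by (intro bellman_contraction) (auto simp: dist_real_def)
  qed
  then obtain v where v: "F v = v"
    using disc banach_fix_type[of "disc M" F] by auto
  have "bellman M (\<lambda>s. apply_bcontfun v (discrete s)) s = apply_bcontfun v (discrete s)" for s
    using F[of v "discrete s"] unfolding v discrete_inverse[OF UNIV_I] by (rule sym)
  then show ?thesis by (intro that ext)
qed

section \<open>The fixed point as the value of a saddle point\<close>

lemma controlled_chain_kernel:
  assumes "\<pi> \<in> policies M" and W: "W \<in> factor_vectors M"
  shows "controlled_chain (nS M) (nA M) \<pi> (kernel M W)"
proof
  fix s a assume s: "s < nS M" and a: "a < nA M"
  have W: "W i \<in> vectors (nS M)" "s' < nS M \<Longrightarrow> 0 \<le> W i s'" "(\<Sum>s'<nS M. W i s') = 1"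
    if "i < nF M" for i s'
    using W factor_prob[OF that] that by (auto simp: factor_vectors_def prob_vectors_def PiE_iff)
  have W_nonneg: "0 \<le> W i s'" if "i < nF M" for i s'
    using W[OF that] by (cases "s' < nS M") (auto simp: vectors_def)
  show "0 \<le> kernel M W s a s'" for s'
    unfolding kernel_def using W_nonneg coef_nonneg[OF s a] by (intro sum_nonneg) auto
  show "kernel M W s a s' = 0" if "nS M \<le> s'" for s'
    unfolding kernel_def using W(1) that by (intro sum.neutral) (auto simp: vectors_def)
  have "(\<Sum>s'<nS M. kernel M W s a s') = (\<Sum>i<nF M. coef M i s a * (\<Sum>s'<nS M. W i s'))"
    unfolding kernel_def by (subst sum.swap) (simp add: sum_distrib_left)
  also have "\<dots> = 1"
    using W(3) coef_sum[OF s a] by simp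
  finally show "(\<Sum>s'<nS M. kernel M W s a s') = 1" .
qed (use assms(1) in \<open>auto simp: policies_def\<close>)

text \<open>Exchanging the sums over states and factors: the kernel enters the lookahead only
  through one product per factor. This is where the rectangular structure is used.\<close>

lemma kernel_dot:
  "rew M s a + disc M * (\<Sum>s'<nS M. kernel M W s a s' * u s') = q_value M (\<lambda>i. dot (nS M) (W i) u) s a"
  unfolding q_value_def kernel_def dot_def sum_distrib_right sum_distrib_left
  by (subst sum.swap) (simp add: mult_ac)

text \<open>With \<open>policy_value_le\<close>, the comparison principle for policy evaluation;
  later arguments about policy values use only these one-step inequalities.\<close>

lemma policy_value_ge:
  assumes "\<pi> \<in> policies M" and "W \<in> factor_vectors M" and "s < nS M"
    and "\<And>s. s < nS M \<Longrightarrow> u s \<le> (\<Sum>a<nA M. pmf (\<pi> s) a * q_value M (\<lambda>i. dot (nS M) (W i) u) s a)"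
  shows "u s \<le> policy_value M \<pi> W s"
proof -
  interpret controlled_chain "nS M" "nA M" \<pi> "kernel M W"
    using assms(1,2) by (rule controlled_chain_kernel)
  show ?thesis
    unfolding policy_value_def using assms(3,4) disc
    by (subst expected_return_eq) (auto intro!: discounted_sum_ge simp: kernel_dot)
qed

lemma policy_value_le:
  assumes "\<pi> \<in> policies M" and "W \<in> factor_vectors M" and "s < nS M"
    and "\<And>s. s < nS M \<Longrightarrow> (\<Sum>a<nA M. pmf (\<pi> s) a * q_value M (\<lambda>i. dot (nS M) (W i) u) s a) \<le> u s"
  shows "policy_value M \<pi> W s \<le> u s"
proof -
  interpret controlled_chain "nS M" "nA M" \<pi> "kernel M W"
    using assms(1,2) by (rule controlled_chain_kernel)
  show ?thesis
    unfolding policy_value_def using assms(3,4) disc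
    by (subst expected_return_eq) (auto intro!: discounted_sum_le simp: kernel_dot)
qed

text \<open>Provides the lower bound that a real infimum over \<open>factor_vectors M\<close>
  requires.\<close>

lemma policy_value_nonneg:
  assumes "\<pi> \<in> policies M" and "W \<in> factor_vectors M" and "s < nS M"
  shows "0 \<le> policy_value M \<pi> W s"
  using assms by (rule policy_value_ge[where u="\<lambda>_. 0"])
    (auto simp: q_value_def dot_def rew_nonneg intro!: sum_nonneg)

lemma robust_value_eq_fixpoint:
  assumes v: "bellman M v = v" and s: "s < nS M"
  shows "robust_value M s = v s"
proof -
  have v_eq: "v s = max_q M (\<lambda>i. worst M i v) s" if "s < nS M" for s
    using fun_cong[OF v, of s] that by (simp add: bellman_def)
  \<comment> \<open>One minimizer per factor, the same for all states, actions and policies; the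
    restricted abstraction makes \<open>W\<close> extensional, as \<open>factor_vectors\<close>
    demands.\<close>
  define W where "W = (\<lambda>i\<in>{..<nF M}. SOME w. w \<in> factor M i \<and> dot (nS M) w v = worst M i v)"
  have W: "W i \<in> factor M i \<and> dot (nS M) (W i) v = worst M i v" if "i < nF M" for i
  proof -
    have "\<exists>w. w \<in> factor M i \<and> dot (nS M) w v = worst M i v"
      using worst_attained[OF that, of v] by blast
    from someI_ex[OF this] show ?thesis
      using that by (simp add: W_def)
  qed
  have W_in: "W \<in> factor_vectors M"
    using W by (auto simp: factor_vectors_def W_def)
  define g where "g s = (SOME a. a < nA M \<and> max_q M (\<lambda>i. worst M i v) s = q_value M (\<lambda>i. worst M i v) s a)" for s
  have g: "g s < nA M \<and> max_q M (\<lambda>i. worst M i v) s = q_value M (\<lambda>i. worst M i v) s (g s)" for s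
    unfolding g_def by (rule someI_ex) (metis max_q_attained)
  let ?g = "\<lambda>s. return_pmf (g s)"
  have g_in: "?g \<in> policies M"
    using g by (simp add: policies_def)
  \<comment> \<open>Against \<open>W\<close> the inner values are exactly the worst ones, so each
    action has lookahead at most \<open>v s\<close>, and so has every average over actions.\<close>
  have upper: "policy_value M \<pi> W s \<le> v s" if \<pi>: "\<pi> \<in> policies M" for \<pi>
  proof (rule policy_value_le[OF \<pi> W_in s])
    fix s assume s: "s < nS M"
    have "q_value M (\<lambda>i. dot (nS M) (W i) v) s a = q_value M (\<lambda>i. worst M i v) s a" for a
      using W by (simp add: q_value_def)
    then have "(\<Sum>a<nA M. pmf (\<pi> s) a * q_value M (\<lambda>i. dot (nS M) (W i) v) s a)
        \<le> (\<Sum>a<nA M. pmf (\<pi> s) a * v s)"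
      using v_eq[OF s] max_q_ge by (intro sum_mono mult_left_mono) auto
    also have "\<dots> = v s"
      using \<pi> s by (simp add: sum_distrib_right[symmetric] sum_pmf_eq_1 policies_def)
    finally show "(\<Sum>a<nA M. pmf (\<pi> s) a * q_value M (\<lambda>i. dot (nS M) (W i) v) s a) \<le> v s" .
  qed
  \<comment> \<open>Any \<open>W'\<close> only raises the inner values above the worst ones, so the
    greedy action keeps its lookahead at or above \<open>v s\<close>.\<close>
  have lower: "v s \<le> policy_value M ?g W' s" if W': "W' \<in> factor_vectors M" for W'
  proof (rule policy_value_ge[OF g_in W' s])
    fix s assume s: "s < nS M"
    have "worst M i v \<le> dot (nS M) (W' i) v + 0" if "i < nF M" for i
      using W' that worst_le[OF that, of "W' i"] by (auto simp: factor_vectors_def)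
    from q_value_mono[OF s conjunct1[OF g] this]
    have "v s \<le> q_value M (\<lambda>i. dot (nS M) (W' i) v) s (g s)"
      using v_eq[OF s] g by simp
    also have "\<dots> = (\<Sum>a<nA M. pmf (?g s) a * q_value M (\<lambda>i. dot (nS M) (W' i) v) s a)"
      using g[of s] by (simp add: indicator_def of_bool_def if_distrib[of "\<lambda>x. x * _"] sum.delta cong: if_cong)
    finally show "v s \<le> (\<Sum>a<nA M. pmf (?g s) a * q_value M (\<lambda>i. dot (nS M) (W' i) v) s a)" .
  qed
  have inf: "(INF W\<in>factor_vectors M. policy_value M \<pi> W s) \<le> v s" if "\<pi> \<in> policies M" for \<pi>
    using upper[OF that] policy_value_nonneg[OF that _ s] W_in
    by (intro cINF_lower2[where x=W] bdd_belowI2[of _ 0]) auto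
  show ?thesis
  proof (rule antisym)
    show "robust_value M s \<le> v s"
      unfolding robust_value_def using g_in inf by (intro cSUP_least) auto
    have "v s \<le> (INF W\<in>factor_vectors M. policy_value M ?g W s)"
      using W_in lower by (intro cINF_greatest) auto
    then show "v s \<le> robust_value M s"
      unfolding robust_value_def using g_in inf by (intro cSUP_upper2[where x="?g"] bdd_aboveI2[of _ _ "v s"]) auto
  qed
qed

end

section \<open>Inexact value iteration\<close>

lemma fst_snd_counted [simp]:
  "fst (free x) = x" "snd (free x) = 0" "fst (op1 x) = x" "snd (op1 x) = 1"
  "fst (bind_counted m f) = fst (f (fst m))" "snd (bind_counted m f) = snd m + snd (f (fst m))"
  by (simp_all add: free_def op1_def bind_counted_def)

lemma fst_sum_counted [simp]: "fst (sum_counted f n) = (\<Sum>i<n. fst (f i))"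
  and snd_sum_counted [simp]: "snd (sum_counted f n) = (\<Sum>i<n. snd (f i)) + n"
  by (induction n) auto

lemma fst_max_counted: "fst (max_counted f n) = (MAX i\<in>{..n}. fst (f i))"
  by (induction n) (simp_all add: atMost_Suc max.commute)

lemma snd_max_counted [simp]: "snd (max_counted f n) = (\<Sum>i\<le>n. snd (f i)) + n"
  by (induction n) auto

lemma fst_vect_counted [simp]: "fst (vect_counted f n) = (\<lambda>i. if i < n then fst (f i) else 0)"
  and snd_vect_counted [simp]: "snd (vect_counted f n) = (\<Sum>i<n. snd (f i))"
  by (induction n) (auto simp: fun_eq_iff less_Suc_eq)

lemma fst_dot_counted [simp]: "fst (dot_counted n x y) = dot n x y"
  and snd_dot_counted [simp]: "snd (dot_counted n x y) = 2 * n"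
  by (simp_all add: dot_counted_def dot_def)

lemma atMost_pred: "0 < n \<Longrightarrow> {..n - Suc 0} = {..<n}"
  by auto

lemma fst_dist_counted_le_iff:
  "0 < n \<Longrightarrow> fst (dist_counted n x y) \<le> b \<longleftrightarrow> (\<forall>s<n. \<bar>x s - y s\<bar> \<le> b)"
  unfolding dist_counted_def fst_max_counted by (subst Max_le_iff) auto

lemma snd_dist_counted: "0 < n \<Longrightarrow> snd (dist_counted n x y) \<le> 3 * n"
  by (simp add: dist_counted_def)

text \<open>\<open>N\<close> is the first index at which the condition fails. The condition may hold
  again later, so \<open>k\<close> serves only as an upper bound on the number of rounds.\<close>

lemma while_option_stops:
  assumes "\<not> b ((c ^^ k) s)"
  obtains N where "N \<le> k" and "while_option b c s = Some ((c ^^ N) s)" and "\<not> b ((c ^^ N) s)"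
proof (rule that[of "LEAST k. \<not> b ((c ^^ k) s)"])
  show "(LEAST k. \<not> b ((c ^^ k) s)) \<le> k"
    using assms by (rule Least_le)
  show "\<not> b ((c ^^ (LEAST k. \<not> b ((c ^^ k) s))) s)"
    using assms by (rule LeastI)
  show "while_option b c s = Some ((c ^^ (LEAST k. \<not> b ((c ^^ k) s))) s)"
    using assms by (auto simp: while_option_def)
qed

locale approximate_vi = compact_rmdp +
  fixes lin :: lin_procedure and \<delta> :: real
  assumes minimizer:
    "\<And>i c. i < nF M \<Longrightarrow> c \<in> vectors (nS M) \<Longrightarrow> eps_minimizer (nS M) (factor M i) c \<delta> (fst (lin i c \<delta>))"
begin

definition update :: "vect \<Rightarrow> vect" where
  "update v = fst (vi_update M lin \<delta> v)"

definition iterate :: "nat \<Rightarrow> vect" where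
  "iterate k = (update ^^ k) (\<lambda>_. 0)"

lemma iterate_simps: "iterate 0 = (\<lambda>_. 0)" "iterate (Suc k) = update (iterate k)"
  by (simp_all add: iterate_def)

lemma update_eq:
  "update v s = (if s < nS M
     then max_q M (\<lambda>i. if i < nF M then dot (nS M) (fst (lin i v \<delta>)) v else 0) s else 0)"
  using sizes by (simp add: update_def vi_update_def fst_max_counted atMost_pred max_q_def q_value_def cong: if_cong)

text \<open>Each factor is minimized once, so the calls of \<open>lin\<close> are not multiplied by
  the numbers of states and actions. As all sizes are at least 1, the inner products cost at most 2
  and the maximization at most 5 times the product of the sizes.\<close>

lemma snd_vi_update:
  "snd (vi_update M lin \<delta> v) \<le> (\<Sum>i<nF M. snd (lin i v \<delta>)) + 7 * (nF M * nS M * nA M)"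
proof -
  have "snd (vi_update M lin \<delta> v)
      = (\<Sum>i<nF M. snd (lin i v \<delta>)) + nF M * (2 * nS M)
        + nS M * (nA M * (2 * nF M + 2) + (nA M - 1))"
    using sizes by (simp add: vi_update_def atMost_pred sum.distrib) (simp add: algebra_simps)
  moreover have "nF M * (2 * nS M) \<le> 2 * (nF M * nS M * nA M)"
    using sizes by simp
  moreover have "nA M * (2 * nF M + 2) + (nA M - 1) \<le> 5 * (nF M * nA M)"
  proof -
    have "nA M \<le> nF M * nA M" using sizes by simp
    moreover have "nA M * (2 * nF M + 2) = 2 * (nF M * nA M) + 2 * nA M"
      by (simp add: algebra_simps)
    ultimately show ?thesis by linarith
  qed
  then have "nS M * (nA M * (2 * nF M + 2) + (nA M - 1)) \<le> nS M * (5 * (nF M * nA M))"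
    by (rule mult_le_mono2)
  moreover have "nS M * (5 * (nF M * nA M)) = 5 * (nF M * nS M * nA M)"
    by simp
  ultimately show ?thesis by linarith
qed

section \<open>Convergence of the inexact iterates\<close>

lemma update_in_vectors: "update v \<in> vectors (nS M)"
  by (simp add: vectors_def update_eq)

text \<open>The guarantee for \<open>lin\<close> covers only cost vectors in
  \<open>vectors (nS M)\<close>.\<close>

lemma iterate_in_vectors: "iterate k \<in> vectors (nS M)"
  by (cases k) (simp_all add: iterate_simps update_in_vectors, simp add: vectors_def)

text \<open>The returned \<open>w\<close> is feasible and cannot undercut the minimum, so the error
  is one-sided; the factor \<open>disc M\<close> damps it.\<close>

lemma update_bounds:
  assumes v: "v \<in> vectors (nS M)" and s: "s < nS M"
  shows "bellman M v s \<le> update v s" and "update v s \<le> bellman M v s + disc M * \<delta>"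
proof -
  have *: "worst M i v \<le> dot (nS M) (fst (lin i v \<delta>)) v \<and> dot (nS M) (fst (lin i v \<delta>)) v \<le> worst M i v + \<delta>"
    if i: "i < nF M" for i
  proof -
    obtain w where "w \<in> factor M i" "dot (nS M) w v = worst M i v"
      using worst_attained[OF i] by blast
    with minimizer[OF i v] worst_le[OF i] show ?thesis
      by (auto simp: eps_minimizer_def dot_commute[of _ v])
  qed
  have "max_q M (\<lambda>i. worst M i v) s
      \<le> max_q M (\<lambda>i. if i < nF M then dot (nS M) (fst (lin i v \<delta>)) v else 0) s + disc M * 0"
    using * by (intro max_q_mono[OF s]) simp
  then show "bellman M v s \<le> update v s"
    using s by (simp add: bellman_def update_eq)
  have "max_q M (\<lambda>i. if i < nF M then dot (nS M) (fst (lin i v \<delta>)) v else 0) s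
      \<le> max_q M (\<lambda>i. worst M i v) s + disc M * \<delta>"
    using * by (intro max_q_mono[OF s]) simp
  then show "update v s \<le> bellman M v s + disc M * \<delta>"
    using s by (simp add: bellman_def update_eq)
qed

text \<open>A \<open>\<delta>\<close>-minimizer belongs to the set and can be compared with
  itself.\<close>

lemma delta_nonneg: "0 \<le> \<delta>"
proof -
  have "eps_minimizer (nS M) (factor M 0) (iterate 0) \<delta> (fst (lin 0 (iterate 0) \<delta>))"
    using sizes iterate_in_vectors by (intro minimizer)
  then show ?thesis by (force simp: eps_minimizer_def)
qed

text \<open>Because the errors are one-sided, they contribute \<open>disc M * \<delta>\<close> once
  and not twice.\<close>

lemma update_contraction:
  assumes "u \<in> vectors (nS M)" "v \<in> vectors (nS M)" and "s < nS M"
    and "\<And>s. s < nS M \<Longrightarrow> \<bar>u s - v s\<bar> \<le> b"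
  shows "\<bar>update u s - update v s\<bar> \<le> disc M * b + disc M * \<delta>"
proof -
  have "\<bar>bellman M u s - bellman M v s\<bar> \<le> disc M * b"
    using assms(3,4) by (intro bellman_contraction) force+
  with update_bounds[OF assms(1,3)] update_bounds[OF assms(2,3)] show ?thesis
    by linarith
qed

text \<open>The bound \<open>x\<close> on a difference becomes
  \<open>disc M * x + disc M * \<delta>\<close> in the next round. The fixed point of this map is
  \<open>disc M * \<delta> / (1 - disc M)\<close>, and the excess over it shrinks
  geometrically.\<close>

lemma iterate_diff_le:
  assumes "\<And>s a. s < nS M \<Longrightarrow> a < nA M \<Longrightarrow> rew M s a \<le> b" and "s < nS M"
  shows "\<bar>iterate (Suc k) s - iterate k s\<bar> \<le> disc M ^ k * b + disc M * \<delta> / (1 - disc M)"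
  using assms(2)
proof (induction k arbitrary: s)
  case 0
  \<comment> \<open>Against the zero vector all products vanish whatever \<open>lin\<close> returns,
    so the first iterate is the largest reward.\<close>
  have "dot (nS M) w (\<lambda>_. 0) = 0" for w
    by (simp add: dot_def)
  then have "update (\<lambda>_. 0) s = (MAX a\<in>{..<nA M}. rew M s a)"
    using 0 by (simp add: update_eq max_q_def q_value_def cong: if_cong)
  moreover have "(MAX a\<in>{..<nA M}. rew M s a) \<in> rew M s ` {..<nA M}"
    using sizes by (intro Max_in) auto
  ultimately have "\<bar>update (\<lambda>_. 0) s\<bar> \<le> b"
    using assms(1) rew_nonneg 0 by auto
  moreover have "0 \<le> disc M * \<delta> / (1 - disc M)"
    using disc delta_nonneg by simp
  ultimately show ?case
    by (simp add: iterate_simps)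
next
  case (Suc k)
  let ?g = "disc M * \<delta> / (1 - disc M)"
  have "\<bar>iterate (Suc (Suc k)) s - iterate (Suc k) s\<bar> \<le> disc M * (disc M ^ k * b + ?g) + disc M * \<delta>"
    unfolding iterate_simps(2)[of "Suc k"] iterate_simps(2)[of k]
    using update_contraction[OF iterate_in_vectors[of "Suc k"] iterate_in_vectors[of k] Suc.prems Suc.IH]
    by (simp add: iterate_simps)
  also have "\<dots> = disc M ^ Suc k * b + ?g"
    using disc by (simp add: field_simps)
  finally show ?case .
qed

text \<open>If \<open>e\<close> is the error of the new iterate, the old one has error at most
  \<open>\<tau> + e\<close>. One more round yields
  \<open>e \<le> disc M * (\<tau> + e) + disc M * \<delta>\<close>, which is solved for
  \<open>e\<close>.\<close>

lemma iterate_Suc_error: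
  assumes v: "bellman M v = v" and s: "s < nS M"
    and diff: "\<And>s. s < nS M \<Longrightarrow> \<bar>iterate (Suc k) s - iterate k s\<bar> \<le> \<tau>"
  shows "\<bar>iterate (Suc k) s - v s\<bar> \<le> disc M * (\<tau> + \<delta>) / (1 - disc M)"
proof -
  define e where "e = (MAX s\<in>{..<nS M}. \<bar>iterate (Suc k) s - v s\<bar>)"
  have e: "\<bar>iterate (Suc k) s - v s\<bar> \<le> e" if "s < nS M" for s
    unfolding e_def using that by (intro Max_ge) auto
  have step: "\<bar>iterate (Suc k) s - v s\<bar> \<le> disc M * (\<tau> + e) + disc M * \<delta>" if s: "s < nS M" for s
  proof -
    have "\<bar>iterate k s - v s\<bar> \<le> \<tau> + e" if "s < nS M" for s
      using diff[OF that] e[OF that] by linarith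
    then have "\<bar>bellman M (iterate k) s - bellman M v s\<bar> \<le> disc M * (\<tau> + e)"
      using s by (intro bellman_contraction) force+
    with update_bounds[OF iterate_in_vectors[of k] s] v show ?thesis
      using disc delta_nonneg by (simp add: iterate_simps)
  qed
  have "e \<in> (\<lambda>s. \<bar>iterate (Suc k) s - v s\<bar>) ` {..<nS M}"
    unfolding e_def using sizes by (intro Max_in) auto
  with step have "e \<le> disc M * (\<tau> + e) + disc M * \<delta>"
    by auto
  then have "e * (1 - disc M) \<le> disc M * (\<tau> + \<delta>)"
    by (simp add: algebra_simps)
  then have "e \<le> disc M * (\<tau> + \<delta>) / (1 - disc M)"
    using disc by (simp add: pos_le_divide_eq)
  with e[OF s] show ?thesis by linarith
qed

section \<open>Result and operation count of the loop\<close>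

abbreviation round_loop :: "real \<Rightarrow> (bool \<times> vect) counted \<Rightarrow> (bool \<times> vect) counted" where
  "round_loop \<tau> c \<equiv> bind_counted c (vi_round M lin \<delta> \<tau>)"

text \<open>Stated from \<open>Suc k\<close> on because the initial flag \<open>True\<close>
  compares no iterates.\<close>

lemma fst_round_loop:
  "fst ((round_loop \<tau> ^^ Suc k) ((True, \<lambda>_. 0), n))
    = (\<tau> < fst (dist_counted (nS M) (iterate (Suc k)) (iterate k)), iterate (Suc k))"
  by (induction k) (simp_all add: vi_round_def iterate_simps update_def)

text \<open>The 11 collects 7 from the update, 3 from the distance and 1 from the test against
  \<open>\<tau>\<close>.\<close>

lemma snd_round_loop:
  assumes "\<And>i c. i < nF M \<Longrightarrow> c \<in> vectors (nS M) \<Longrightarrow> real (snd (lin i c \<delta>)) \<le> B i"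
  shows "real (snd ((round_loop \<tau> ^^ k) ((True, \<lambda>_. 0), n)))
    \<le> real n + real k * ((\<Sum>i<nF M. B i) + 11 * real (nF M * nS M * nA M))"
proof (induction k)
  case (Suc k)
  let ?st = "fst ((round_loop \<tau> ^^ k) ((True, \<lambda>_. 0), n))"
  have st: "snd ?st = iterate k"
    by (cases k) (simp_all only: fst_round_loop, simp_all add: iterate_simps)
  have "nS M \<le> nF M * nS M * nA M" "1 \<le> nF M * nS M * nA M"
    using sizes by simp_all
  moreover have "snd (vi_round M lin \<delta> \<tau> ?st) \<le> snd (vi_update M lin \<delta> (iterate k)) + 3 * nS M + 1"
    using snd_dist_counted[OF sizes(1)] by (simp add: vi_round_def st)
  ultimately have "snd (vi_round M lin \<delta> \<tau> ?st) \<le> (\<Sum>i<nF M. snd (lin i (iterate k) \<delta>)) + 11 * (nF M * nS M * nA M)"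
    using snd_vi_update[of "iterate k"] by linarith
  then have "real (snd (vi_round M lin \<delta> \<tau> ?st))
      \<le> (\<Sum>i<nF M. real (snd (lin i (iterate k) \<delta>))) + 11 * real (nF M * nS M * nA M)"
    unfolding of_nat_sum[symmetric] by linarith
  also have "(\<Sum>i<nF M. real (snd (lin i (iterate k) \<delta>))) \<le> (\<Sum>i<nF M. B i)"
    using assms iterate_in_vectors by (intro sum_mono) auto
  finally show ?case
    using Suc by (simp add: algebra_simps)
qed simp

end

section \<open>Iteration count and total cost\<close>

lemma accuracies_eq:
  "accuracies l \<epsilon> = (((1 - l)\<^sup>2 * \<epsilon> / 4, (1 - l) * \<epsilon> / 2), 5)"
  by (simp add: accuracies_def prod_eq_iff power2_eq_square)

lemma (in approximate_vi) vi_pi_result: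
  assumes eps: "0 < \<epsilon>" and \<delta>: "\<delta> = (1 - disc M)\<^sup>2 * \<epsilon> / 4"
    and rew: "\<And>s a. s < nS M \<Longrightarrow> a < nA M \<Longrightarrow> rew M s a \<le> Rmax"
    and k: "disc M ^ k * Rmax \<le> (1 - disc M) * \<epsilon> / 4"
    and B: "\<And>i c. i < nF M \<Longrightarrow> c \<in> vectors (nS M) \<Longrightarrow> real (snd (lin i c \<delta>)) \<le> B i"
  obtains v n where "vi_pi M lin \<epsilon> = Some (v, n)" and "eps_optimal M \<epsilon> v"
    and "real n \<le> 5 + real (Suc k) * ((\<Sum>i<nF M. B i) + 11 * real (nF M * nS M * nA M))"
proof -
  define \<tau> where "\<tau> = (1 - disc M) * \<epsilon> / 2"
  let ?loop = "\<lambda>k. (round_loop \<tau> ^^ k) ((True, \<lambda>_. 0), 5)"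
  \<comment> \<open>Inexactness takes at most half of \<open>\<tau>\<close>; the other half,
    \<open>(1 - disc M) * \<epsilon> / 4\<close>, is what the assumption on \<open>k\<close> leaves
    to the geometric term.\<close>
  have slack: "disc M * \<delta> / (1 - disc M) \<le> \<tau> / 2"
  proof -
    have "disc M * \<delta> / (1 - disc M) = disc M * (\<tau> / 2)"
      using disc by (simp add: \<delta> \<tau>_def power2_eq_square field_simps)
    also have "\<dots> \<le> \<tau> / 2"
      using disc eps by (intro mult_left_le_one_le) (auto simp: \<tau>_def)
    finally show ?thesis .
  qed
  moreover have "disc M ^ k * Rmax \<le> \<tau> / 2"
    using k by (simp add: \<tau>_def)
  ultimately have "\<bar>iterate (Suc k) s - iterate k s\<bar> \<le> \<tau>" if "s < nS M" for s
    using iterate_diff_le[OF rew that, of k] by linarith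
  then have "\<not> fst (fst (?loop (Suc k)))"
    unfolding fst_round_loop using sizes by (simp add: not_less fst_dist_counted_le_iff)
  then obtain N where N: "N \<le> Suc k" "\<not> fst (fst (?loop N))"
    and loop: "while_option (\<lambda>x. fst (fst x)) (round_loop \<tau>) ((True, \<lambda>_. 0), 5) = Some (?loop N)"
    by (rule while_option_stops)
  from N(2) obtain j where j: "N = Suc j"
    by (cases N) auto
  have "?loop N = ((False, iterate N), snd (?loop N))"
    using N(2) unfolding j prod_eq_iff fst_round_loop by simp
  with loop have "while_option (\<lambda>x. fst (fst x)) (round_loop \<tau>) ((True, \<lambda>_. 0), 5)
      = Some ((False, iterate N), snd (?loop N))"
    by (rule trans[OF _ arg_cong[where f=Some]])
  moreover have "(\<lambda>(st, _). fst st) = (\<lambda>x :: (bool \<times> vect) counted. fst (fst x))"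
    by auto
  ultimately have result: "vi_pi M lin \<epsilon> = Some (iterate N, snd (?loop N))"
    by (simp add: vi_pi_def accuracies_eq \<delta>[symmetric] \<tau>_def[symmetric] del: funpow.simps)
  have "eps_optimal M \<epsilon> (iterate N)"
    unfolding eps_optimal_def
  proof (intro allI impI)
    fix s assume s: "s < nS M"
    obtain v where v: "bellman M v = v"
      by (rule bellman_fixpoint)
    have "\<bar>iterate (Suc j) s - iterate j s\<bar> \<le> \<tau>" if "s < nS M" for s
      using N(2) that sizes unfolding j fst_round_loop by (simp add: not_less fst_dist_counted_le_iff)
    from iterate_Suc_error[OF v s this]
    have "\<bar>iterate N s - robust_value M s\<bar> \<le> disc M * (\<tau> + \<delta>) / (1 - disc M)"
      by (simp add: j robust_value_eq_fixpoint[OF v s])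
    \<comment> \<open>Here \<open>\<tau> / (1 - disc M)\<close> is \<open>\<epsilon> / 2\<close> and
      \<open>\<delta> / (1 - disc M)\<close> is
      \<open>(1 - disc M) * \<epsilon> / 4\<close>.\<close>
    also have "\<dots> = disc M * ((3 - disc M) / 4) * \<epsilon>"
      using disc by (simp add: \<tau>_def \<delta> power2_eq_square field_simps)
    also have "\<dots> \<le> 1 * \<epsilon>"
      using disc eps by (intro mult_right_mono mult_le_one) auto
    finally show "\<bar>iterate N s - robust_value M s\<bar> \<le> \<epsilon>" by simp
  qed
  moreover have "real (snd (?loop N)) \<le> 5 + real (Suc k) * ((\<Sum>i<nF M. B i) + 11 * real (nF M * nS M * nA M))"
  proof -
    \<comment> \<open>\<open>B i\<close> bounds a natural number; its sign allows \<open>N\<close>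
      to be replaced by \<open>Suc k\<close>.\<close>
    have "0 \<le> B i" if "i < nF M" for i
      using B[OF that iterate_in_vectors[of 0]] by linarith
    then have "real N * ((\<Sum>i<nF M. B i) + 11 * real (nF M * nS M * nA M))
        \<le> real (Suc k) * ((\<Sum>i<nF M. B i) + 11 * real (nF M * nS M * nA M))"
      using N(1) by (intro mult_right_mono) (auto intro!: add_nonneg_nonneg sum_nonneg)
    with snd_round_loop[OF B, where \<tau>=\<tau> and k=N and n=5] show ?thesis by simp
  qed
  ultimately show ?thesis using result that by blast
qed

text \<open>Take logarithms and round up the solution of \<open>l ^ x = c * exp (- L)\<close>. The
  last assumption makes that solution nonnegative, so the conversion to \<open>nat\<close> is
  harmless.\<close>

lemma log_many_powers:
  fixes l c L :: real
  assumes "0 < l" "l < 1" and "0 < c" and "0 \<le> ln (1 / c) + L"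
  obtains k where "l ^ k \<le> c * exp (- L)" and "real k \<le> (ln (1 / c) + L) / ln (1 / l) + 1"
proof
  define x where "x = (ln (1 / c) + L) / ln (1 / l)"
  have l: "0 < ln (1 / l)"
    using assms by simp
  have x: "0 \<le> x"
    unfolding x_def using assms(4) l by simp
  let ?k = "nat \<lceil>x\<rceil>"
  show "real ?k \<le> (ln (1 / c) + L) / ln (1 / l) + 1"
    unfolding x_def[symmetric] using x by linarith
  have "x * ln (1 / l) \<le> real ?k * ln (1 / l)"
    using l by (intro mult_right_mono) (auto simp: real_nat_ceiling_ge)
  then have "real ?k * ln l \<le> ln c + - L"
    using l assms by (simp add: x_def ln_div)
  then have "exp (real ?k * ln l) \<le> exp (ln c + - L)"
    by simp
  then show "l ^ ?k \<le> c * exp (- L)"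
    using assms by (simp only: exp_add exp_of_nat_mult exp_ln)
qed

theorem theorem5p1:
  fixes lam Rmax C e0 :: real
  assumes "0 < lam" and "lam < 1" and "0 \<le> Rmax" and "0 < C" and "0 < e0" and "e0 < 1"
  shows "\<exists>K>0. \<forall>(M :: rmdp) (lin :: lin_procedure) (cplx :: nat \<Rightarrow> real) (\<epsilon> :: real).
    r_rectangular_mdp M \<and> disc M = lam \<and> (\<forall>s<nS M. \<forall>a<nA M. rew M s a \<le> Rmax) \<and>
    tractable M lin cplx C e0 \<and> 0 < \<epsilon> \<and> \<epsilon> \<le> e0 \<longrightarrow>
    (\<exists>v n. vi_pi M lin \<epsilon> = Some (v, n) \<and> eps_optimal M \<epsilon> v \<and>
       real n \<le> K * (real (nF M * nS M * nA M) * ln (1 / \<epsilon>)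
                      + (\<Sum>i<nF M. cplx i * (ln (1 / \<epsilon>))\<^sup>2)))"
proof -
  \<comment> \<open>A positive lower bound for \<open>ln (1 / \<epsilon>)\<close>: additive
    constants are absorbed by multiplying them with \<open>L / L0\<close>.\<close>
  define L0 where "L0 = ln (1 / e0)"
  \<comment> \<open>Chosen so that \<open>c * \<epsilon> * (Rmax + 1)\<close> is the target
    \<open>(1 - lam) * \<epsilon> / 4\<close>; the added 1 covers \<open>Rmax = 0\<close>.\<close>
  define c where "c = (1 - lam) / (4 * (Rmax + 1))"
  \<comment> \<open>\<open>K1 * L\<close> will bound the number of rounds and \<open>K2 * L\<close>
    the logarithm of the inverse inner accuracy. The 2 consists of 1 for rounding up and 1 for
    \<open>Suc k\<close>.\<close>
  define K1 where "K1 = (ln (1 / c) / L0 + 1) / ln (1 / lam) + 2 / L0"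
  define K2 where "K2 = ln (4 / (1 - lam)\<^sup>2) / L0 + 1"
  have L0: "0 < L0"
    using assms by (simp add: L0_def)
  have c: "0 < c" "c < 1"
    using assms by (simp_all add: c_def field_simps)
  have K1: "0 < K1"
    unfolding K1_def using L0 c assms by (intro add_nonneg_pos divide_nonneg_pos add_nonneg_nonneg) auto
  have "(1 - lam)\<^sup>2 \<le> 1"
    using assms by (simp add: power_le_one)
  then have K2: "0 < K2"
    unfolding K2_def using L0 assms by (intro add_nonneg_pos divide_nonneg_pos ln_ge_zero) (auto simp: field_simps)
  show ?thesis
  \<comment> \<open>The summands pay for computing the accuracies, for the arithmetic of the rounds
    and for the calls of \<open>lin\<close>.\<close>
  proof (intro exI[of _ "5 / L0 + 11 * K1 + K1 * C * K2"] conjI allI impI; (elim conjE)?)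
    show "0 < 5 / L0 + 11 * K1 + K1 * C * K2"
      using L0 K1 K2 assms by (intro add_pos_pos mult_pos_pos divide_pos_pos) auto
  next
    fix M lin cplx \<epsilon>
    assume rect: "r_rectangular_mdp M" and lam: "disc M = lam"
      and rew: "\<forall>s<nS M. \<forall>a<nA M. rew M s a \<le> Rmax"
      and tract: "tractable M lin cplx C e0" and eps: "0 < \<epsilon>" "\<epsilon> \<le> e0"
    define L where "L = ln (1 / \<epsilon>)"
    define \<delta> where "\<delta> = (1 - disc M)\<^sup>2 * \<epsilon> / 4"
    have L: "L0 \<le> L"
      using eps assms by (simp add: L0_def L_def ln_div)
    have "(1 - lam)\<^sup>2 / 4 \<le> 1"
      using \<open>(1 - lam)\<^sup>2 \<le> 1\<close> by simp
    from mult_right_mono[OF this, of \<epsilon>] have "\<delta> \<le> \<epsilon>"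
      using eps by (simp add: \<delta>_def lam)
    then have \<delta>: "0 < \<delta>" "\<delta> \<le> e0"
      using eps assms by (simp add: \<delta>_def lam) (use \<open>\<delta> \<le> \<epsilon>\<close> eps in linarith)
    interpret approximate_vi M lin \<delta>
      using rect tract \<delta> by unfold_locales (auto simp: tractable_def)
    have cost: "real (snd (lin i v \<delta>)) \<le> C * cplx i * ln (1 / \<delta>)" if "i < nF M" "v \<in> vectors (nS M)" for i v
      using tract \<delta> that by (auto simp: tractable_def)
    have ln_\<delta>: "0 < ln (1 / \<delta>)" "ln (1 / \<delta>) \<le> K2 * L"
    proof -
      show "0 < ln (1 / \<delta>)"
        using \<delta> assms by simp
      have "ln (1 / \<delta>) = ln (4 / (1 - lam)\<^sup>2 * (1 / \<epsilon>))"
        by (simp add: \<delta>_def lam)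
      also have "\<dots> = ln (4 / (1 - lam)\<^sup>2) + L"
        unfolding L_def using assms eps by (subst ln_mult) auto
      also have "\<dots> \<le> ln (4 / (1 - lam)\<^sup>2) * (L / L0) + L"
      proof -
        have "0 \<le> ln (4 / (1 - lam)\<^sup>2)"
          using \<open>(1 - lam)\<^sup>2 \<le> 1\<close> assms by (intro ln_ge_zero) (auto simp: field_simps)
        from mult_left_mono[of 1 "L / L0", OF _ this] show ?thesis
          using L L0 by simp
      qed
      finally show "ln (1 / \<delta>) \<le> K2 * L"
        by (simp add: K2_def algebra_simps)
    qed
    \<comment> \<open>The sign is forced: an operation count is at most a positive multiple of
      \<open>cplx i\<close>.\<close>
    have cplx: "0 \<le> cplx i" if "i < nF M" for i
    proof -
      have "0 \<le> C * ln (1 / \<delta>) * cplx i"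
        using cost[OF that iterate_in_vectors[of 0]] by (simp add: mult_ac)
      moreover have "0 < C * ln (1 / \<delta>)"
        using assms ln_\<delta>(1) by (intro mult_pos_pos)
      ultimately show ?thesis
        by (simp only: zero_le_mult_iff) linarith
    qed
    have ln_c: "0 < ln (1 / c)"
      using c by simp
    obtain k where k: "lam ^ k \<le> c * exp (- L)" "real k \<le> (ln (1 / c) + L) / ln (1 / lam) + 1"
      using log_many_powers[OF assms(1,2) c(1), of L] ln_c L L0 by auto
    have "exp (- L) = \<epsilon>"
      using eps by (simp add: L_def ln_div)
    with k(1) have "lam ^ k * Rmax \<le> c * \<epsilon> * (Rmax + 1)"
      using assms c(1) by (intro mult_mono) auto
    also have "\<dots> = (1 - lam) * \<epsilon> / 4"
      using assms by (simp add: c_def divide_simps)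
    finally have "disc M ^ k * Rmax \<le> (1 - disc M) * \<epsilon> / 4"
      by (simp add: lam)
    then obtain v n where res: "vi_pi M lin \<epsilon> = Some (v, n)" "eps_optimal M \<epsilon> v"
      and n: "real n \<le> 5 + real (Suc k) * ((\<Sum>i<nF M. C * cplx i * ln (1 / \<delta>)) + 11 * real (nF M * nS M * nA M))"
      using vi_pi_result[of \<epsilon> Rmax k "\<lambda>i. C * cplx i * ln (1 / \<delta>)"] rew cost eps
      by (auto simp: \<delta>_def)
    define G where "G = real (nF M * nS M * nA M)"
    define S where "S = (\<Sum>i<nF M. cplx i)"
    have G: "1 \<le> G"
    proof -
      have "0 < nF M * nS M * nA M" using sizes by simp
      then show ?thesis unfolding G_def by linarith
    qed
    have S: "0 \<le> S"
      unfolding S_def using cplx by (intro sum_nonneg) auto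
    have rounds: "real (Suc k) \<le> K1 * L"
    proof -
      have "real (Suc k) \<le> (ln (1 / c) * 1 + L) / ln (1 / lam) + 2 * 1"
        using k(2) by simp
      also have "\<dots> \<le> (ln (1 / c) * (L / L0) + L) / ln (1 / lam) + 2 * (L / L0)"
        using ln_c L L0 assms
        by (intro add_mono divide_right_mono mult_left_mono) auto
      also have "\<dots> = K1 * L"
        using L0 by (simp add: K1_def algebra_simps add_divide_distrib)
      finally show ?thesis .
    qed
    have sum: "(\<Sum>i<nF M. C * cplx i * ln (1 / \<delta>)) = C * S * ln (1 / \<delta>)"
      by (simp add: S_def sum_distrib_left sum_distrib_right)
    have "0 \<le> C * S * ln (1 / \<delta>)" "C * S * ln (1 / \<delta>) \<le> C * S * (K2 * L)"
      using ln_\<delta> S assms by (auto intro!: mult_nonneg_nonneg mult_left_mono)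
    then have "real (Suc k) * ((\<Sum>i<nF M. C * cplx i * ln (1 / \<delta>)) + 11 * G)
        \<le> K1 * L * (C * S * (K2 * L) + 11 * G)"
      using rounds K1 L L0 G unfolding sum by (intro mult_mono) auto
    \<comment> \<open>Absorbs the 5 operations of \<open>accuracies\<close>.\<close>
    moreover have "1 * 1 \<le> G * (L / L0)"
      using G L L0 by (intro mult_mono) auto
    ultimately have "real n \<le> 5 * (G * (L / L0)) + K1 * L * (C * S * (K2 * L) + 11 * G)"
      using n by (simp add: G_def)
    \<comment> \<open>The squared logarithm is the product of the number of rounds and the cost of a
      call of \<open>lin\<close>, each linear in \<open>L\<close>.\<close>
    also have "\<dots> = (5 / L0 + 11 * K1) * (G * L) + K1 * C * K2 * (S * L\<^sup>2)"
      by (simp add: algebra_simps power2_eq_square)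
    also have "\<dots> \<le> (5 / L0 + 11 * K1 + K1 * C * K2) * (G * L) + (5 / L0 + 11 * K1 + K1 * C * K2) * (S * L\<^sup>2)"
    proof -
      have "0 \<le> K1 * C * K2" "0 \<le> 5 / L0 + 11 * K1" "0 \<le> G * L" "0 \<le> S * L\<^sup>2"
        using G S L L0 K1 K2 assms by simp_all
      then show ?thesis
        by (intro add_mono[OF mult_right_mono mult_right_mono]) linarith+
    qed
    also have "\<dots> = (5 / L0 + 11 * K1 + K1 * C * K2) * (G * L + (\<Sum>i<nF M. cplx i * L\<^sup>2))"
      by (simp add: S_def sum_distrib_right distrib_left)
    finally show "\<exists>v n. vi_pi M lin \<epsilon> = Some (v, n) \<and> eps_optimal M \<epsilon> v \<and>
       real n \<le> (5 / L0 + 11 * K1 + K1 * C * K2) * (real (nF M * nS M * nA M) * ln (1 / \<epsilon>)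
                      + (\<Sum>i<nF M. cplx i * (ln (1 / \<epsilon>))\<^sup>2))"
      using res unfolding G_def L_def by blast
  qed
qed

end
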